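(* Let $q$ be a prime power, $\nu\ge1$, and let $X_1$---$X_2$ and $Y_1$---$Y_2$ be edges of $Spi(2\nu,q)$. Then these two edges are in the same orbit of the edge set under the action of $\mathrm{Aut}(Spi(2\nu,q))$ if and only if one of the following holds: (1) $t(X_1)=t(Y_1)$, $t(X_2)=t(Y_2)$ and $t(X_1+X_2)=t(Y_1+Y_2)$; (2) $t(X_1)=t(Y_2)$, $t(X_2)=t(Y_1)$ and $t(X_1+X_2)=t(Y_1+Y_2)$.
   Context: $\mathbb{F}_q^{(2\nu)}$ is the space of row vectors of length $2\nu$ over $\mathbb{F}_q$ and $K_{2\nu}=\begin{pmatrix}0 & I^{(\nu)}\\ -I^{(\nu)} & 0\end{pmatrix}$. A subspace $P$ of dimension $m$ is identified with any $m\times2\nu$ matrix whose rows form a basis of $P$; $P$ is of type $(m,s)$ if $PK_{2\nu}{}^tP$ has rank $2s$, and $t(P)=(m,s)$ denotes its type. The graph $Spi(2\nu,q)$ has as vertex set all subspaces of $\mathbb{F}_q^{(2\nu)}$ other than $0$ and $\mathbb{F}_q^{(2\nu)}$, with an (unordered) edge $A$---$B$ between $A,B$ (not necessarily distinct) iff $AK_{2\nu}{}^tB=0$. $\mathrm{Aut}(Spi(2\nu,q))$ is the automorphism group of this graph, acting on edges by $\sigma:\{A,B\}\mapsto\{\sigma(A),\sigma(B)\}$. *)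

theory Defs
  imports "Jordan_Normal_Form.DL_Rank" "HOL-Algebra.Group_Action"
begin

text \<open>
  The field \<open>\<F>\<^sub>q\<close> is a type \<open>'a\<close> that is a finite field, with \<open>q = CARD('a)\<close>; row vectors
  of length \<open>2\<nu>\<close> are the elements of \<open>carrier_vec (2 * \<nu>)\<close>.
\<close>

abbreviation row_vectors :: "nat \<Rightarrow> ('a::field, 'a vec) module" where
  "row_vectors \<nu> \<equiv> module_vec TYPE('a) (2 * \<nu>)"

definition symp_K :: "nat \<Rightarrow> 'a::field mat" where
  "symp_K \<nu> = four_block_mat (0\<^sub>m \<nu> \<nu>) (1\<^sub>m \<nu>) (- 1\<^sub>m \<nu>) (0\<^sub>m \<nu> \<nu>)"

definition represents :: "nat \<Rightarrow> nat \<Rightarrow> 'a::field mat \<Rightarrow> 'a vec set \<Rightarrow> bool" where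
  "represents \<nu> m M P \<longleftrightarrow>
     M \<in> carrier_mat m (2 * \<nu>) \<and> distinct (rows M) \<and>
     vectorspace.basis class_ring (row_vectors \<nu>\<lparr>carrier := P\<rparr>) (set (rows M))"

text \<open>
  \<open>m\<close> is the dimension of \<open>P\<close>, being the number of rows of a matrix whose rows form a basis.
  The rank does not depend on the choice of that matrix.
\<close>

definition has_type :: "nat \<Rightarrow> 'a::field vec set \<Rightarrow> nat \<times> nat \<Rightarrow> bool" where
  "has_type \<nu> P = (\<lambda>(m, s). \<exists>M. represents \<nu> m M P \<and>
     vec_space.rank m (M * symp_K \<nu> * M\<^sup>T) = 2 * s)"

definition subspace_type :: "nat \<Rightarrow> 'a::field vec set \<Rightarrow> nat \<times> nat" where
  "subspace_type \<nu> P = (THE t. has_type \<nu> P t)"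

abbreviation subspace_sum :: "nat \<Rightarrow> 'a::field vec set \<Rightarrow> 'a vec set \<Rightarrow> 'a vec set" where
  "subspace_sum \<nu> \<equiv> LinearCombinations.module.submodule_sum (row_vectors \<nu>)"

definition Spi_verts :: "nat \<Rightarrow> 'a::field vec set set" where
  "Spi_verts \<nu> = {P. VectorSpace.subspace class_ring P (row_vectors \<nu>) \<and>
     P \<noteq> {0\<^sub>v (2 * \<nu>)} \<and> P \<noteq> carrier_vec (2 * \<nu>)}"

definition Spi_adj :: "nat \<Rightarrow> 'a::field vec set \<Rightarrow> 'a vec set \<Rightarrow> bool" where
  "Spi_adj \<nu> A B \<longleftrightarrow> (\<exists>m n M N. represents \<nu> m M A \<and> represents \<nu> n N B \<and>
     M * symp_K \<nu> * N\<^sup>T = 0\<^sub>m m n)"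

text \<open>Unordered edges; a loop at \<open>A\<close> is the singleton \<open>{A, A}\<close>.\<close>

definition Spi_edges :: "nat \<Rightarrow> 'a::field vec set set set" where
  "Spi_edges \<nu> = {{A, B} | A B. A \<in> Spi_verts \<nu> \<and> B \<in> Spi_verts \<nu> \<and> Spi_adj \<nu> A B}"

definition graph_Aut :: "'v set \<Rightarrow> 'v set set \<Rightarrow> ('v \<Rightarrow> 'v) monoid" where
  "graph_Aut V E = BijGroup V\<lparr>carrier :=
     {\<sigma> \<in> Bij V. \<forall>A\<in>V. \<forall>B\<in>V. {A, B} \<in> E \<longleftrightarrow> {\<sigma> A, \<sigma> B} \<in> E}\<rparr>"

definition edge_action :: "'v set set \<Rightarrow> ('v \<Rightarrow> 'v) \<Rightarrow> 'v set \<Rightarrow> 'v set" where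
  "edge_action E \<sigma> = (\<lambda>e\<in>E. \<sigma> ` e)"

abbreviation Spi_Aut :: "nat \<Rightarrow> ('a::field vec set \<Rightarrow> 'a vec set) monoid" where
  "Spi_Aut \<nu> \<equiv> graph_Aut (Spi_verts \<nu>) (Spi_edges \<nu>)"

abbreviation Spi_edge_orbits :: "nat \<Rightarrow> 'a::field vec set set set set" where
  "Spi_edge_orbits \<nu> \<equiv> orbits (Spi_Aut \<nu>) (Spi_edges \<nu>) (edge_action (Spi_edges \<nu>))"

end

theory Submission
  imports Defs "HOL-Library.Function_Algebras" "HOL-Library.Product_Plus" "HOL-Library.Cardinality"
begin

text \<open>
  Over a field with \<open>q\<close> elements a subspace of type \<open>(m, s)\<close> has \<open>q\<^sup>m\<close> elements and its radical has
  \<open>q\<^bsup>m - 2s\<^esup>\<close>, so the type is the same information as the two cardinalities, and dimension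
  arguments become counting arguments.

  A graph automorphism \<open>\<sigma>\<close> preserves inclusion, because \<open>A \<subseteq> B\<close> holds iff every neighbour of \<open>B\<close> is a
  neighbour of \<open>A\<close>. Hence it preserves dimensions, intersections and radicals \<open>A \<inter> A\<^sup>\<bottom>\<close>, and for an
  edge these data determine the type of the sum.

  Conversely, let \<open>X\<^sub>1\<close>, \<open>X\<^sub>2\<close> be orthogonal. Then \<open>X\<^sub>1 \<inter> X\<^sub>2\<close> lies in both radicals, and its dimension is
  determined by the three types. A linear bijection \<open>X\<^sub>1 \<inter> X\<^sub>2 \<rightarrow> Y\<^sub>1 \<inter> Y\<^sub>2\<close> extends to the radicals, then
  to isometries \<open>X\<^sub>1 \<rightarrow> Y\<^sub>1\<close> and \<open>X\<^sub>2 \<rightarrow> Y\<^sub>2\<close>; these glue to an isometry of the sums, and Witt's extension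
  argument yields an isometry of the whole space, which induces the required automorphism.
\<close>

section \<open>Counting in spaces with an alternating form\<close>

text \<open>What shapes the proof is that intersections, radicals and sums of vertices may be
  \<open>0\<close> or the whole space and then are not vertices, so an automorphism cannot be
  applied to them. Hence radicals are treated as intersections \<open>A \<inter> perp V A\<close> of
  two vertices, intersections are compared by inequalities that apply to an automorphism and to its
  inverse, and sums are reached by \<open>|A + B| |A \<inter> B| = |A| |B|\<close> and, for
  orthogonal \<open>A\<close>, \<open>B\<close>, by
  \<open>|rad (A + B)| |A \<inter> B| = |rad A| |rad B|\<close>. In the other direction the order of
  extension is forced: an isometry of a degenerate space carries radical onto radical, so Witt's
  argument starts only once the radicals are matched. Counting replaces dual spaces: the number of
  functionals is bounded from above, and the pairing between \<open>W\<close> and a subspace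
  \<open>Q\<close> that contains \<open>rad W\<close> forces equality in that bound. The form is
  alternating, so a newly adjoined vector has no length to be matched, and characteristic 2 requires
  no separate treatment.\<close>

lemma card_eq_card_kernel_times_card_image:
  fixes h :: "'x::ab_group_add \<Rightarrow> 'y::ab_group_add"
  assumes fin: "finite P"
    and add: "\<And>x y. x \<in> P \<Longrightarrow> y \<in> P \<Longrightarrow> x + y \<in> P"
    and diff: "\<And>x y. x \<in> P \<Longrightarrow> y \<in> P \<Longrightarrow> x - y \<in> P"
    and h: "\<And>x y. x \<in> P \<Longrightarrow> y \<in> P \<Longrightarrow> h (x + y) = h x + h y"
  shows "card P = card {x \<in> P. h x = 0} * card (h ` P)"
proof -
  \<comment> \<open>A nonempty fibre is a translate of the kernel by any of its elements
    \<open>x0\<close>.\<close>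
  have fiber: "card {x \<in> P. h x = y} = card {x \<in> P. h x = 0}" if y: "y \<in> h ` P" for y
  proof -
    obtain x0 where x0: "x0 \<in> P" "h x0 = y" using y by auto
    have "h (x - x0) = 0" if "x \<in> P" "h x = y" for x
      using h[of "x - x0" x0] diff that x0 by simp
    moreover have "h (x + x0) = y" if "x \<in> P" "h x = 0" for x
      using h[of x x0] that x0 by simp
    ultimately have "bij_betw (\<lambda>x. x - x0) {x \<in> P. h x = y} {x \<in> P. h x = 0}"
      using x0 add diff by (intro bij_betwI[where g = "\<lambda>x. x + x0"]) auto
    then show ?thesis by (rule bij_betw_same_card)
  qed
  have "card P = (\<Sum>y\<in>h ` P. card {x \<in> P. h x = y})"
    using sum.image_gen[OF fin, of "\<lambda>_. 1::nat" h] by simp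
  also have "\<dots> = card {x \<in> P. h x = 0} * card (h ` P)"
    using fiber by simp
  finally show ?thesis .
qed

lemma card_field_ge_2: "2 \<le> CARD('a::{field,finite})"
proof -
  have "card {0::'a, 1} \<le> CARD('a)" by (rule card_mono) auto
  then show ?thesis by simp
qed

text \<open>\<open>b x x = 0\<close> instead of skew-symmetry keeps characteristic 2 in scope.
  Degenerate subspaces are essential to the argument, so nondegeneracy is imposed later, on one
  subspace \<open>V\<close>; finiteness is imposed on subspaces, since the intended
  \<open>'v\<close> is an infinite type of functions.\<close>

locale alternating_form = vector_space scale
  for scale :: "'a::{field,finite} \<Rightarrow> 'v::ab_group_add \<Rightarrow> 'v" (infixr \<open>*s\<close> 75) +
  fixes b :: "'v \<Rightarrow> 'v \<Rightarrow> 'a"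
  assumes b_add_left: "b (x + y) z = b x z + b y z"
    and b_add_right: "b x (y + z) = b x y + b x z"
    and b_scale_left: "b (c *s x) y = c * b x y"
    and b_scale_right: "b x (c *s y) = c * b x y"
    and b_self: "b x x = 0"
begin

lemma b_swap: "b x y = - b y x"
proof -
  have "b (x + y) (x + y) = 0" by (rule b_self)
  then show ?thesis
    unfolding b_add_left b_add_right by (simp add: b_self eq_neg_iff_add_eq_0 add.commute)
qed

lemma b_zero_left [simp]: "b 0 y = 0"
  using b_scale_left[of 0 0 y] by simp

lemma b_zero_right [simp]: "b x 0 = 0"
  using b_scale_right[of x 0 0] by simp

lemma b_diff_left: "b (x - y) z = b x z - b y z"
  using b_add_left[of "x - y" y z] by simp

lemma b_orthogonal_sym: "b x y = 0 \<longleftrightarrow> b y x = 0"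
  using b_swap[of x y] by simp

section \<open>Adjoining a vector, and hyperplanes\<close>

definition adjoin :: "'v set \<Rightarrow> 'v \<Rightarrow> 'v set" where
  "adjoin P v = {p + c *s v | p c. p \<in> P}"

lemma subset_adjoin: "P \<subseteq> adjoin P v"
proof
  fix p assume "p \<in> P"
  then have "p = p + 0 *s v \<and> p \<in> P" by simp
  then show "p \<in> adjoin P v" unfolding adjoin_def by blast
qed

lemma in_adjoin: "subspace P \<Longrightarrow> v \<in> adjoin P v"
  unfolding adjoin_def using subspace_0[of P] by (auto intro!: exI[of _ 0] exI[of _ 1])

lemma adjoin_subset: "subspace Q \<Longrightarrow> P \<subseteq> Q \<Longrightarrow> v \<in> Q \<Longrightarrow> adjoin P v \<subseteq> Q"
  unfolding adjoin_def by (auto intro!: subspace_add subspace_scale)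

lemma subspace_adjoin:
  assumes P: "subspace P"
  shows "subspace (adjoin P v)"
proof (rule subspaceI)
  show "0 \<in> adjoin P v" using subset_adjoin subspace_0[OF P] by blast
next
  fix x y assume "x \<in> adjoin P v" "y \<in> adjoin P v"
  then obtain p c p' c' where *: "p \<in> P" "p' \<in> P" "x = p + c *s v" "y = p' + c' *s v"
    unfolding adjoin_def by auto
  then have "x + y = (p + p') + (c + c') *s v" by (simp add: scale_left_distrib)
  then show "x + y \<in> adjoin P v" unfolding adjoin_def using * subspace_add[OF P] by blast
next
  fix a x assume "x \<in> adjoin P v"
  then obtain p c where *: "p \<in> P" "x = p + c *s v"
    unfolding adjoin_def by auto
  then have "a *s x = a *s p + (a * c) *s v" by (simp add: scale_right_distrib)
  then show "a *s x \<in> adjoin P v" unfolding adjoin_def using * subspace_scale[OF P] by blast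
qed

lemma scale_in_subspace_iff:
  assumes P: "subspace P" and "v \<notin> P"
  shows "c *s v \<in> P \<longleftrightarrow> c = 0"
proof
  assume "c *s v \<in> P"
  then have "inverse c *s c *s v \<in> P" by (rule subspace_scale[OF P])
  then show "c = 0" using assms(2) by (cases "c = 0") auto
qed (simp add: subspace_0[OF P])

lemma card_adjoin:
  assumes P: "subspace P" and fin: "finite P" and v: "v \<notin> P"
  shows "card (adjoin P v) = CARD('a) * card P"
proof -
  have "inj_on (\<lambda>(p, c). p + c *s v) (P \<times> UNIV)"
  proof (rule inj_onI, clarsimp)
    fix p c p' c' assume *: "p \<in> P" "p' \<in> P" "p + c *s v = p' + c' *s v"
    have "(c - c') *s v = p' - p" using *(3) by (simp add: scale_left_diff_distrib algebra_simps)
    then have "(c - c') *s v \<in> P" using * subspace_diff[OF P] by simp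
    then show "p = p' \<and> c = c'" using scale_in_subspace_iff[OF P v] *(3) by simp
  qed
  moreover have "adjoin P v = (\<lambda>(p, c). p + c *s v) ` (P \<times> UNIV)"
    unfolding adjoin_def by force
  ultimately show ?thesis by (simp add: card_image card_cartesian_product)
qed

lemma card_subspace_pos: "subspace P \<Longrightarrow> finite P \<Longrightarrow> 0 < card P"
  using subspace_0 by (metis card_gt_0_iff empty_iff)

lemma card_eq_card_kernel_times_card_image_subspace:
  fixes h :: "'v \<Rightarrow> 'y::ab_group_add"
  assumes "finite P" "subspace P"
    and "\<And>x y. x \<in> P \<Longrightarrow> y \<in> P \<Longrightarrow> h (x + y) = h x + h y"
  shows "card P = card {x \<in> P. h x = 0} * card (h ` P)"
  using assms by (intro card_eq_card_kernel_times_card_image) (auto intro: subspace_add subspace_diff)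

text \<open>A vector of \<open>A\<close> outside \<open>B\<close> can be adjoined to
  \<open>B\<close> without leaving \<open>A\<close>. This is the cardinality form of the fact that a
  proper inclusion raises the dimension by at least one.\<close>

lemma card_mult_le_if_psubset:
  assumes A: "subspace A" "finite A" and B: "subspace B" "B \<subset> A"
  shows "CARD('a) * card B \<le> card A"
proof -
  obtain v where v: "v \<in> A" "v \<notin> B" using B(2) by blast
  have "card (adjoin B v) = CARD('a) * card B"
    using card_adjoin[OF B(1) finite_subset v(2)] A(2) B(2) by blast
  moreover have "adjoin B v \<subseteq> A" using adjoin_subset[OF A(1)] B(2) v(1) by blast
  ultimately show ?thesis using card_mono[OF A(2)] by metis
qed

text \<open>A maximal proper subspace is a hyperplane, since adjoining any further vector must give
  all of \<open>A\<close>; \<open>{0}\<close> shows that there is a candidate.\<close>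

lemma hyperplane_exists:
  assumes A: "subspace A" "finite A" "A \<noteq> {0}"
  obtains B where "subspace B" "B \<subset> A" "card A = CARD('a) * card B"
proof -
  let ?F = "{B. subspace B \<and> B \<subset> A}"
  have "?F \<subseteq> Pow A" by blast
  then have "finite ?F" using A(2) by (auto intro: finite_subset)
  moreover have "{0} \<in> ?F" using A subspace_0[OF A(1)] by auto
  ultimately obtain B where B: "B \<in> ?F" "\<forall>C\<in>?F. B \<subseteq> C \<longrightarrow> B = C"
    using finite_has_maximal2[of ?F "{0}"] by blast
  have sB: "subspace B" "B \<subset> A" using B(1) by auto
  then obtain v where v: "v \<in> A" "v \<notin> B" by blast
  have "adjoin B v \<subseteq> A" using adjoin_subset[OF A(1)] sB(2) v(1) by blast
  moreover have "v \<in> adjoin B v" by (rule in_adjoin[OF sB(1)])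
  ultimately have "adjoin B v = A"
    using B(2) subspace_adjoin[OF sB(1), of v] subset_adjoin[of B v] v(2) by blast
  then have "card A = CARD('a) * card B"
    using card_adjoin[OF sB(1) finite_subset v(2)] A(2) sB(2) by blast
  then show thesis using that sB by blast
qed

text \<open>The dual of the quotient \<open>Q / R\<close>. The value 0 prescribed outside
  \<open>Q\<close> makes a functional on \<open>Q\<close> a single function, so that the set is
  finite and can be counted.\<close>

definition functionals :: "'v set \<Rightarrow> 'v set \<Rightarrow> ('v \<Rightarrow> 'a) set" where
  "functionals Q R = {f. (\<forall>x\<in>Q. \<forall>y\<in>Q. f (x + y) = f x + f y) \<and> (\<forall>c. \<forall>x\<in>Q. f (c *s x) = c * f x) \<and>
     (\<forall>x\<in>R. f x = 0) \<and> (\<forall>x. x \<notin> Q \<longrightarrow> f x = 0)}"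

lemma finite_functionals: "finite Q \<Longrightarrow> finite (functionals Q R)"
proof -
  assume "finite Q"
  then have "finite {f::'v \<Rightarrow> 'a. \<forall>x. (x \<in> Q \<longrightarrow> f x \<in> UNIV) \<and> (x \<notin> Q \<longrightarrow> f x = 0)}"
    by (intro finite_set_of_finite_funs) auto
  then show ?thesis by (rule rev_finite_subset) (auto simp: functionals_def)
qed

text \<open>The dual of \<open>Q / R\<close> is no larger than \<open>Q / R\<close> itself.
  Adjoining \<open>v\<close> to \<open>R\<close> enlarges \<open>R\<close> by the factor
  \<open>q\<close>, while evaluation at \<open>v\<close> shows that at most a factor
  \<open>q\<close> of functionals is lost; the induction ends at \<open>R = Q\<close>.\<close>

lemma card_functionals_le:
  assumes fin: "finite Q" and Q: "subspace Q" and "subspace R" "R \<subseteq> Q"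
  shows "card (functionals Q R) * card R \<le> card Q"
  using assms(3,4)
proof (induction "card Q - card R" arbitrary: R rule: less_induct)
  case less
  show ?case
  proof (cases "R = Q")
    case True
    then have "f = 0" if "f \<in> functionals Q R" for f
      using that unfolding functionals_def fun_eq_iff zero_fun_apply by blast
    then have "functionals Q R \<subseteq> {0}" by blast
    then have "card (functionals Q R) \<le> card {0::'v \<Rightarrow> 'a}" by (intro card_mono) auto
    then show ?thesis using True by simp
  next
    case False
    then obtain v where v: "v \<in> Q" "v \<notin> R" using less.prems by auto
    have finR: "finite R" using fin less.prems finite_subset by blast
    let ?R = "adjoin R v"
    have R': "subspace ?R" "?R \<subseteq> Q"
      using subspace_adjoin less.prems adjoin_subset Q v by auto
    have cardR': "card ?R = CARD('a) * card R" by (rule card_adjoin[OF less.prems(1) finR v(2)])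
    have "R \<subset> Q" using False less.prems by auto
    then have "card R < card Q" using fin by (rule psubset_card_mono[rotated])
    moreover have "card R < card ?R"
      using cardR' card_field_ge_2[where 'a='a] card_subspace_pos[OF less.prems(1) finR] by simp
    ultimately have IH: "card (functionals Q ?R) * card ?R \<le> card Q"
      using less.hyps[OF _ R'] by simp
    have ker: "{f \<in> functionals Q R. f v = 0} = functionals Q ?R"
    proof (intro equalityI subsetI)
      fix f assume f: "f \<in> {f \<in> functionals Q R. f v = 0}"
      have "f (p + c *s v) = 0" if "p \<in> R" for p c
        using f that v less.prems(2) subspace_scale[OF Q] by (auto simp: functionals_def subset_iff)
      then show "f \<in> functionals Q ?R"
        using f by (auto simp: functionals_def adjoin_def)
    next
      fix f assume "f \<in> functionals Q ?R"
      then show "f \<in> {f \<in> functionals Q R. f v = 0}"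
        using subset_adjoin[of R v] in_adjoin[OF less.prems(1), of v] by (auto simp: functionals_def subset_iff)
    qed
    have "card (functionals Q R) = card {f \<in> functionals Q R. f v = 0} * card ((\<lambda>f. f v) ` functionals Q R)"
      using finite_functionals[OF fin, of R]
      by (rule card_eq_card_kernel_times_card_image) (auto simp: functionals_def algebra_simps)
    also have "\<dots> \<le> card (functionals Q ?R) * CARD('a)"
      unfolding ker by (intro mult_left_mono card_mono) auto
    finally have "card (functionals Q R) * card R \<le> card (functionals Q ?R) * CARD('a) * card R"
      by (rule mult_right_mono) simp
    then show ?thesis using IH unfolding cardR' mult.assoc by (rule le_trans)
  qed
qed

section \<open>Orthogonal complements and radicals\<close>

definition perp :: "'v set \<Rightarrow> 'v set \<Rightarrow> 'v set" where
  "perp W Q = {w \<in> W. \<forall>y\<in>Q. b w y = 0}"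

abbreviation rad :: "'v set \<Rightarrow> 'v set" where
  "rad W \<equiv> perp W W"

lemma subspace_perp: "subspace W \<Longrightarrow> subspace (perp W Q)"
  by (rule subspaceI)
    (auto simp: perp_def subspace_0 subspace_add subspace_scale b_add_left b_scale_left)

lemma perp_subset: "perp W Q \<subseteq> W"
  by (auto simp: perp_def)

text \<open>Each of \<open>W\<close> and \<open>Q\<close> maps to the functionals on the other one; comparing the two resulting
  inequalities shows that both maps are onto.\<close>

lemma
  assumes fin: "finite W" and W: "subspace W" and Q: "subspace Q" "Q \<subseteq> W" and rad: "rad W \<subseteq> Q"
  shows card_perp: "card Q * card (perp W Q) = card W * card (rad W)"
    and functional_representation:
      "\<lbrakk>\<And>x y. x \<in> Q \<Longrightarrow> y \<in> Q \<Longrightarrow> f (x + y) = f x + f y; \<And>c x. x \<in> Q \<Longrightarrow> f (c *s x) = c * f x;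
        \<And>x. x \<in> rad W \<Longrightarrow> f x = 0\<rbrakk> \<Longrightarrow> \<exists>w\<in>W. \<forall>y\<in>Q. f y = b w y"
proof -
  define h where "h w = (\<lambda>y. if y \<in> Q then b w y else 0)" for w
  define k where "k y = (\<lambda>w. if w \<in> W then b w y else 0)" for y
  have finQ: "finite Q" using fin Q finite_subset by blast
  have hF: "h ` W \<subseteq> functionals Q (rad W)"
    using Q subspace_add[OF Q(1)] subspace_scale[OF Q(1)]
    by (auto simp: h_def functionals_def b_add_right b_scale_right perp_def b_orthogonal_sym)
  have kF: "k ` Q \<subseteq> functionals W (perp W Q)"
    using W subspace_add[OF W] subspace_scale[OF W]
    by (auto simp: k_def functionals_def b_add_left b_scale_left perp_def)
  have "{w \<in> W. h w = 0} = perp W Q"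
    by (auto simp: h_def perp_def fun_eq_iff)
  moreover have "card W = card {w \<in> W. h w = 0} * card (h ` W)"
    by (rule card_eq_card_kernel_times_card_image_subspace[OF fin W])
       (auto simp: h_def fun_eq_iff b_add_left)
  ultimately have cW: "card W = card (perp W Q) * card (h ` W)" by simp
  \<comment> \<open>Because \<open>rad W\<close> lies in \<open>Q\<close>, the vectors of
    \<open>Q\<close> that pair to zero with \<open>W\<close> make up all of
    \<open>rad W\<close>.\<close>
  have "{y \<in> Q. k y = 0} = rad W"
    using rad Q by (auto simp: k_def perp_def fun_eq_iff b_orthogonal_sym)
  moreover have "card Q = card {y \<in> Q. k y = 0} * card (k ` Q)"
    by (rule card_eq_card_kernel_times_card_image_subspace[OF finQ Q(1)])
       (auto simp: k_def fun_eq_iff b_add_right)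
  ultimately have cQ: "card Q = card (rad W) * card (k ` Q)" by simp
  have finF: "finite (functionals Q (rad W))" "finite (functionals W (perp W Q))"
    using finite_functionals fin finQ by auto
  have le1: "card (functionals Q (rad W)) * card (rad W) \<le> card Q"
    by (rule card_functionals_le[OF finQ Q(1) subspace_perp[OF W] rad])
  have "card (functionals W (perp W Q)) * card (perp W Q) \<le> card W"
    by (rule card_functionals_le[OF fin W subspace_perp[OF W] perp_subset])
  then have le2: "card (k ` Q) * card (perp W Q) \<le> card W"
    using card_mono[OF finF(2) kF] by (meson le_trans mult_le_mono1)
  have le3: "card (h ` W) \<le> card (functionals Q (rad W))" by (rule card_mono[OF finF(1) hF])
  have pos: "0 < card (perp W Q)" "0 < card (rad W)"
    by (rule card_subspace_pos[OF subspace_perp[OF W] finite_subset[OF perp_subset fin]])+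
  \<comment> \<open>\<open>A\<close> comes from the map \<open>k\<close>, the chain
    \<open>B\<close>, \<open>C\<close> from the map \<open>h\<close>. The two bounds are opposite,
    so every inequality on the way is an equality, in particular \<open>le3\<close>, which makes
    \<open>h\<close> surjective.\<close>
  have A: "card Q * card (perp W Q) \<le> card W * card (rad W)"
    unfolding cQ using mult_le_mono2[OF le2, of "card (rad W)"] by (simp add: mult_ac)
  have "card W * card (rad W) = card (perp W Q) * (card (h ` W) * card (rad W))"
    unfolding cW by simp
  also have "\<dots> \<le> card (perp W Q) * (card (functionals Q (rad W)) * card (rad W))"
    using le3 by simp
  finally have B: "card W * card (rad W) \<le> card (perp W Q) * (card (functionals Q (rad W)) * card (rad W))" .
  also have C: "\<dots> \<le> card (perp W Q) * card Q"
    using le1 by simp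
  finally show eq: "card Q * card (perp W Q) = card W * card (rad W)" using A by (simp add: mult.commute)
  have "card (perp W Q) * (card (functionals Q (rad W)) * card (rad W)) = card W * card (rad W)"
    using B C eq pos by (simp add: mult.commute)
  then have "card (functionals Q (rad W)) = card (h ` W)"
    unfolding cW using pos by simp
  then have onto: "h ` W = functionals Q (rad W)"
    using card_subset_eq[OF finF(1) hF] by simp
  show "\<exists>w\<in>W. \<forall>y\<in>Q. f y = b w y"
    if f: "\<And>x y. x \<in> Q \<Longrightarrow> y \<in> Q \<Longrightarrow> f (x + y) = f x + f y" "\<And>c x. x \<in> Q \<Longrightarrow> f (c *s x) = c * f x"
      "\<And>x. x \<in> rad W \<Longrightarrow> f x = 0"
  proof -
    have "(\<lambda>y. if y \<in> Q then f y else 0) \<in> functionals Q (rad W)"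
      using f rad subspace_add[OF Q(1)] subspace_scale[OF Q(1)] by (auto simp: functionals_def)
    then obtain w where w: "w \<in> W" "(\<lambda>y. if y \<in> Q then f y else 0) = h w" unfolding onto[symmetric] by auto
    have "f y = b w y" if "y \<in> Q" for y using fun_cong[OF w(2), of y] that by (simp add: h_def)
    then show ?thesis using w(1) by blast
  qed
qed


section \<open>Extension of isometries\<close>

text \<open>An isometry from a subspace of \<open>W\<close> into \<open>W'\<close> is encoded by its graph, so that extending or
  gluing isometries amounts to enlarging or adding subsets of \<open>W \<times> W'\<close>.\<close>

definition isometry_graph :: "'v set \<Rightarrow> 'v set \<Rightarrow> ('v \<times> 'v) set \<Rightarrow> bool" where
  "isometry_graph W W' \<Gamma> \<longleftrightarrow> \<Gamma> \<subseteq> W \<times> W' \<and> (0, 0) \<in> \<Gamma> \<and>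
     (\<forall>x y x' y'. (x, y) \<in> \<Gamma> \<longrightarrow> (x', y') \<in> \<Gamma> \<longrightarrow> (x + x', y + y') \<in> \<Gamma>) \<and>
     (\<forall>c x y. (x, y) \<in> \<Gamma> \<longrightarrow> (c *s x, c *s y) \<in> \<Gamma>) \<and>
     (\<forall>x y. (x, y) \<in> \<Gamma> \<longrightarrow> (x = 0 \<longleftrightarrow> y = 0)) \<and>
     (\<forall>x y x' y'. (x, y) \<in> \<Gamma> \<longrightarrow> (x', y') \<in> \<Gamma> \<longrightarrow> b x x' = b y y')"

context
  fixes W W' \<Gamma>
  assumes \<Gamma>: "isometry_graph W W' \<Gamma>"
begin

lemma isometry_graph_add: "(x, y) \<in> \<Gamma> \<Longrightarrow> (x', y') \<in> \<Gamma> \<Longrightarrow> (x + x', y + y') \<in> \<Gamma>"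
  using \<Gamma>[unfolded isometry_graph_def] by simp

lemma isometry_graph_scale: "(x, y) \<in> \<Gamma> \<Longrightarrow> (c *s x, c *s y) \<in> \<Gamma>"
  using \<Gamma>[unfolded isometry_graph_def] by simp

lemma isometry_graph_zero: "(0, 0) \<in> \<Gamma>"
  using \<Gamma>[unfolded isometry_graph_def] by (elim conjE)

lemma isometry_graph_zero_iff: "(x, y) \<in> \<Gamma> \<Longrightarrow> x = 0 \<longleftrightarrow> y = 0"
  using \<Gamma>[unfolded isometry_graph_def] by simp

lemma isometry_graph_form: "(x, y) \<in> \<Gamma> \<Longrightarrow> (x', y') \<in> \<Gamma> \<Longrightarrow> b x x' = b y y'"
  using \<Gamma>[unfolded isometry_graph_def] by simp

lemma isometry_graph_subset: "\<Gamma> \<subseteq> W \<times> W'"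
  using \<Gamma>[unfolded isometry_graph_def] by (elim conjE)

lemma isometry_graph_diff:
  assumes "(x, y) \<in> \<Gamma>" "(x', y') \<in> \<Gamma>"
  shows "(x - x', y - y') \<in> \<Gamma>"
  using isometry_graph_add[OF assms(1) isometry_graph_scale[OF assms(2), of "-1"]] by simp

lemma isometry_graph_eq_iff: "(x, y) \<in> \<Gamma> \<Longrightarrow> (x', y') \<in> \<Gamma> \<Longrightarrow> x = x' \<longleftrightarrow> y = y'"
  using isometry_graph_zero_iff[OF isometry_graph_diff, of x y x' y'] by simp

lemma isometry_graph_converse: "isometry_graph W' W (\<Gamma>\<inverse>)"
  unfolding isometry_graph_def
  using isometry_graph_subset isometry_graph_zero isometry_graph_zero_iff isometry_graph_add
    isometry_graph_scale isometry_graph_form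
  by (intro conjI allI impI; simp; blast)

lemma isometry_graph_mono:
  assumes "W \<subseteq> U" "W' \<subseteq> U'"
  shows "isometry_graph U U' \<Gamma>"
proof -
  have "\<Gamma> \<subseteq> U \<times> U'" using isometry_graph_subset assms by blast
  then show ?thesis
    using conjunct2[OF \<Gamma>[unfolded isometry_graph_def]] unfolding isometry_graph_def by (rule conjI)
qed

lemma subspace_isometry_graph_Image:
  assumes "subspace P"
  shows "subspace (\<Gamma> `` P)"
proof (rule subspaceI)
  show "0 \<in> \<Gamma> `` P" using isometry_graph_zero subspace_0[OF assms] by blast
  show "y + y' \<in> \<Gamma> `` P" if yy': "y \<in> \<Gamma> `` P" "y' \<in> \<Gamma> `` P" for y y'
  proof -
    obtain x x' where "(x, y) \<in> \<Gamma>" "(x', y') \<in> \<Gamma>" "x \<in> P" "x' \<in> P" using yy' by blast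
    then show ?thesis using isometry_graph_add subspace_add[OF assms] by (intro ImageI)
  qed
  show "c *s y \<in> \<Gamma> `` P" if y: "y \<in> \<Gamma> `` P" for c y
  proof -
    obtain x where "(x, y) \<in> \<Gamma>" "x \<in> P" using y by blast
    then show ?thesis using isometry_graph_scale subspace_scale[OF assms] by (intro ImageI)
  qed
qed

lemma subspace_Range_isometry_graph: "subspace (Range \<Gamma>)"
proof -
  have "Range \<Gamma> = \<Gamma> `` UNIV" by blast
  then show ?thesis using subspace_isometry_graph_Image[OF subspace_UNIV] by simp
qed

lemma card_isometry_graph_Image:
  assumes "P \<subseteq> Domain \<Gamma>"
  shows "card (\<Gamma> `` P) = card P"
proof -
  define g where "g x = (SOME y. (x, y) \<in> \<Gamma>)" for x
  have g: "(x, g x) \<in> \<Gamma>" if "x \<in> P" for x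
    unfolding g_def using assms that by (auto intro: someI)
  have "inj_on g P"
  proof (rule inj_onI)
    fix x x' assume "x \<in> P" "x' \<in> P" "g x = g x'"
    then show "x = x'" using isometry_graph_eq_iff[OF g g, of x x'] by simp
  qed
  moreover have "g ` P = \<Gamma> `` P"
  proof (intro equalityI subsetI)
    fix y assume "y \<in> \<Gamma> `` P"
    then obtain x where "x \<in> P" "(x, y) \<in> \<Gamma>" by blast
    then have "y = g x" using isometry_graph_eq_iff[OF _ g, of x y x] by simp
    then show "y \<in> g ` P" using \<open>x \<in> P\<close> by blast
  qed (use g in blast)
  ultimately show ?thesis using card_image by metis
qed

lemma isometry_graph_converse_Image:
  assumes "P \<subseteq> Domain \<Gamma>"
  shows "\<Gamma>\<inverse> `` (\<Gamma> `` P) = P"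
proof (intro equalityI subsetI)
  fix x assume "x \<in> \<Gamma>\<inverse> `` (\<Gamma> `` P)"
  then obtain y x' where *: "(x, y) \<in> \<Gamma>" "(x', y) \<in> \<Gamma>" "x' \<in> P" by blast
  then show "x \<in> P" using isometry_graph_eq_iff[OF *(1,2)] by simp
next
  fix x assume "x \<in> P"
  then show "x \<in> \<Gamma>\<inverse> `` (\<Gamma> `` P)" using assms by blast
qed

end

lemma subspace_Domain_isometry_graph: "isometry_graph W W' \<Gamma> \<Longrightarrow> subspace (Domain \<Gamma>)"
  using subspace_Range_isometry_graph[OF isometry_graph_converse] by simp

text \<open>Sends \<open>v\<close> to \<open>w\<close>. Linear independence on both sides keeps the
  relation well defined and injective; \<open>b v v\<close> and \<open>b w w\<close> both vanish, so
  the products with the old domain are all that has to match.\<close>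

lemma isometry_graph_adjoin:
  assumes \<Gamma>: "isometry_graph W W' \<Gamma>" and W: "subspace W" "subspace W'"
    and v: "v \<in> W" "v \<notin> Domain \<Gamma>" and w: "w \<in> W'" "w \<notin> Range \<Gamma>"
    and vw: "\<And>x y. (x, y) \<in> \<Gamma> \<Longrightarrow> b v x = b w y"
  shows "\<exists>\<Delta>. isometry_graph W W' \<Delta> \<and> \<Gamma> \<subset> \<Delta>"
proof -
  define \<Delta> where "\<Delta> = {(x + c *s v, y + c *s w) | x y c. (x, y) \<in> \<Gamma>}"
  have mem: "(x + c *s v, y + c *s w) \<in> \<Delta>" if "(x, y) \<in> \<Gamma>" for x y c
    unfolding \<Delta>_def using that by blast
  have elim: "\<exists>x y c. p = x + c *s v \<and> q = y + c *s w \<and> (x, y) \<in> \<Gamma>" if "(p, q) \<in> \<Delta>" for p q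
    using that unfolding \<Delta>_def by blast
  have "\<Gamma> \<subseteq> \<Delta>" using mem[where c = 0] by auto
  moreover have "(v, w) \<in> \<Delta>" using mem[OF isometry_graph_zero[OF \<Gamma>], of 1] by simp
  ultimately have "\<Gamma> \<subset> \<Delta>" using v by blast
  moreover have "isometry_graph W W' \<Delta>"
    unfolding isometry_graph_def
  proof (intro conjI allI impI)
    show "\<Delta> \<subseteq> W \<times> W'"
      using isometry_graph_subset[OF \<Gamma>] v w W unfolding \<Delta>_def
      by (auto intro!: subspace_add subspace_scale)
    show "(0, 0) \<in> \<Delta>" using \<open>\<Gamma> \<subseteq> \<Delta>\<close> isometry_graph_zero[OF \<Gamma>] by blast
  next
    fix p q p' q' assume "(p, q) \<in> \<Delta>" "(p', q') \<in> \<Delta>"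
    then obtain x y c x' y' c' where *: "(x, y) \<in> \<Gamma>" "(x', y') \<in> \<Gamma>" "p = x + c *s v" "q = y + c *s w"
      "p' = x' + c' *s v" "q' = y' + c' *s w"
      using elim[of p q] elim[of p' q'] by blast
    show "(p + p', q + q') \<in> \<Delta>"
      using mem[OF isometry_graph_add[OF \<Gamma> *(1,2)], of "c + c'"] *
      by (simp add: scale_left_distrib algebra_simps)
    have "b x v = b y w" "b x' v = b y' w"
      using vw[OF *(1)] vw[OF *(2)] b_swap[of x v] b_swap[of y w] b_swap[of x' v] b_swap[of y' w] by auto
    then show "b p p' = b q q'"
      using vw[OF *(1)] vw[OF *(2)] isometry_graph_form[OF \<Gamma> *(1,2)] *
      by (simp add: b_add_left b_add_right b_scale_left b_scale_right b_self)
  next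
    fix a p q assume "(p, q) \<in> \<Delta>"
    then obtain x y c where *: "(x, y) \<in> \<Gamma>" "p = x + c *s v" "q = y + c *s w"
      using elim[of p q] by blast
    show "(a *s p, a *s q) \<in> \<Delta>"
      using mem[OF isometry_graph_scale[OF \<Gamma> *(1)], of a "a * c"] *
      by (simp add: scale_right_distrib)
  next
    fix p q assume "(p, q) \<in> \<Delta>"
    then obtain x y c where *: "(x, y) \<in> \<Gamma>" "p = x + c *s v" "q = y + c *s w"
      using elim[of p q] by blast
    have D: "subspace (Domain \<Gamma>)" and R: "subspace (Range \<Gamma>)"
      using subspace_Domain_isometry_graph subspace_Range_isometry_graph \<Gamma> by blast+
    have "x \<in> Domain \<Gamma>" "y \<in> Range \<Gamma>" using *(1) by auto
    then have neg: "- x \<in> Domain \<Gamma>" "- y \<in> Range \<Gamma>" using subspace_neg D R by blast+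
    have "c = 0" if "p = 0"
    proof -
      have "c *s v = - x" using that * by (simp add: eq_neg_iff_add_eq_0 add.commute)
      then show ?thesis using scale_in_subspace_iff[OF D v(2), of c] neg by simp
    qed
    moreover have "c = 0" if "q = 0"
    proof -
      have "c *s w = - y" using that * by (simp add: eq_neg_iff_add_eq_0 add.commute)
      then show ?thesis using scale_in_subspace_iff[OF R w(2), of c] neg by simp
    qed
    moreover have "p = 0 \<longleftrightarrow> q = 0" if "c = 0"
      using isometry_graph_zero_iff[OF \<Gamma> *(1)] *(2,3) that by simp
    ultimately show "p = 0 \<longleftrightarrow> q = 0" by blast
  qed
  ultimately show ?thesis by blast
qed

lemma card_Range_isometry_graph:
  assumes "isometry_graph W W' \<Gamma>"
  shows "card (Range \<Gamma>) = card (Domain \<Gamma>)"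
proof -
  have "\<Gamma> `` Domain \<Gamma> = Range \<Gamma>" by blast
  then show ?thesis using card_isometry_graph_Image[OF assms order_refl] by simp
qed

text \<open>\<open>W \<times> W'\<close> has finitely many subsets, so extension arguments may pass
  to a graph without proper extension and only have to adjoin one vector.\<close>

lemma maximal_isometry_graph:
  assumes \<Gamma>: "isometry_graph W W' \<Gamma>" and fin: "finite W" "finite W'"
  obtains \<Delta> where "isometry_graph W W' \<Delta>" "\<Gamma> \<subseteq> \<Delta>" "\<And>\<Theta>. isometry_graph W W' \<Theta> \<Longrightarrow> \<not> \<Delta> \<subset> \<Theta>"
proof -
  have "\<Delta> \<in> Pow (W \<times> W')" if "isometry_graph W W' \<Delta>" for \<Delta>
    using isometry_graph_subset[OF that] by simp
  then have "{\<Delta>. isometry_graph W W' \<Delta> \<and> \<Gamma> \<subseteq> \<Delta>} \<subseteq> Pow (W \<times> W')" by blast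
  then have "finite {\<Delta>. isometry_graph W W' \<Delta> \<and> \<Gamma> \<subseteq> \<Delta>}"
    using fin by (auto intro: finite_subset)
  then obtain \<Delta> where "isometry_graph W W' \<Delta>" "\<Gamma> \<subseteq> \<Delta>"
    "\<forall>\<Theta>. isometry_graph W W' \<Theta> \<and> \<Gamma> \<subseteq> \<Theta> \<longrightarrow> \<Delta> \<subseteq> \<Theta> \<longrightarrow> \<Delta> = \<Theta>"
    using finite_has_maximal2[of "{\<Delta>. isometry_graph W W' \<Delta> \<and> \<Gamma> \<subseteq> \<Delta>}" \<Gamma>] \<Gamma> by auto
  then show thesis by (intro that[of \<Delta>]) auto
qed

lemma Domain_isometry_graph_iff_Range:
  assumes \<Gamma>: "isometry_graph W W' \<Gamma>" and fin: "finite W" "finite W'" and "card W = card W'"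
  shows "Domain \<Gamma> = W \<longleftrightarrow> Range \<Gamma> = W'"
proof -
  have "card (Range \<Gamma>) = card (Domain \<Gamma>)"
    by (rule card_Range_isometry_graph[OF \<Gamma>])
  moreover have "Domain \<Gamma> \<subseteq> W" "Range \<Gamma> \<subseteq> W'"
    using isometry_graph_subset[OF \<Gamma>] by auto
  ultimately show ?thesis
    using card_subset_eq[OF fin(1), of "Domain \<Gamma>"] card_subset_eq[OF fin(2), of "Range \<Gamma>"] assms(4) by metis
qed

text \<open>Where the form vanishes, an isometry is just an injective linear map, so any two vectors
  outside domain and range may be matched. Equal cardinality guarantees that both are available at
  once.\<close>

lemma isometry_graph_extension_isotropic:
  assumes W: "subspace W" "subspace W'" "finite W" "finite W'" "card W = card W'"
    and iso: "rad W = W" "rad W' = W'"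
    and \<Gamma>: "isometry_graph W W' \<Gamma>"
  obtains \<Delta> where "isometry_graph W W' \<Delta>" "\<Gamma> \<subseteq> \<Delta>" "Domain \<Delta> = W" "Range \<Delta> = W'"
proof -
  obtain \<Delta> where \<Delta>: "isometry_graph W W' \<Delta>" "\<Gamma> \<subseteq> \<Delta>" "\<And>\<Theta>. isometry_graph W W' \<Theta> \<Longrightarrow> \<not> \<Delta> \<subset> \<Theta>"
    using maximal_isometry_graph[OF \<Gamma>] W by blast
  have sub: "Domain \<Delta> \<subseteq> W" "Range \<Delta> \<subseteq> W'" using isometry_graph_subset[OF \<Delta>(1)] by auto
  have "Domain \<Delta> = W"
  proof (rule ccontr)
    assume "Domain \<Delta> \<noteq> W"
    then have "Range \<Delta> \<noteq> W'" using Domain_isometry_graph_iff_Range[OF \<Delta>(1)] W by blast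
    then obtain v w where vw: "v \<in> W" "v \<notin> Domain \<Delta>" "w \<in> W'" "w \<notin> Range \<Delta>"
      using \<open>Domain \<Delta> \<noteq> W\<close> sub by blast
    have "b v x = b w y" if "(x, y) \<in> \<Delta>" for x y
    proof -
      have "x \<in> W" "y \<in> W'" using that isometry_graph_subset[OF \<Delta>(1)] by auto
      moreover have "v \<in> rad W" "w \<in> rad W'" using vw iso by auto
      ultimately show ?thesis by (simp add: perp_def)
    qed
    then show False using isometry_graph_adjoin[OF \<Delta>(1) W(1,2) vw] \<Delta>(3) by blast
  qed
  then show thesis using that \<Delta> Domain_isometry_graph_iff_Range[OF \<Delta>(1)] W by blast
qed

text \<open>Vectors \<open>w\<close> with the prescribed products exist by \<open>functional_representation\<close>; they form a coset of
  \<open>Q\<^sup>\<bottom>\<close>, where \<open>P\<close> and \<open>Q\<close> are domain and range. If all of them lay in \<open>Q\<close>, then \<open>Q\<^sup>\<bottom> \<subseteq> Q\<close>, so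
  \<open>P\<^sup>\<bottom> \<subseteq> P\<close> by counting; but \<open>v - p\<close> with \<open>p \<in> P\<close> the preimage of \<open>w\<close> violates this.\<close>

lemma isometry_graph_witt_step:
  assumes W: "subspace W" "subspace W'" "finite W" "finite W'" "card W = card W'"
    and \<Gamma>: "isometry_graph W W' \<Gamma>"
    and radW: "rad W \<subseteq> Domain \<Gamma>" "\<Gamma> `` rad W = rad W'"
    and v: "v \<in> W" "v \<notin> Domain \<Gamma>"
  shows "\<exists>w. w \<in> W' \<and> w \<notin> Range \<Gamma> \<and> (\<forall>x y. (x, y) \<in> \<Gamma> \<longrightarrow> b v x = b w y)"
proof -
  let ?P = "Domain \<Gamma>" and ?Q = "Range \<Gamma>"
  have P: "subspace ?P" "?P \<subseteq> W" and Q: "subspace ?Q" "?Q \<subseteq> W'"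
    using subspace_Domain_isometry_graph subspace_Range_isometry_graph isometry_graph_subset \<Gamma> by blast+
  have radW': "rad W' \<subseteq> ?Q" using radW by auto
  \<comment> \<open>\<open>f\<close> is the functional \<open>b v\<close> carried to the range along
    \<Gamma>. A representing vector \<open>w\<close> is the wanted image of \<open>v\<close>, except
    that it may lie in the range.\<close>
  define f where "f y = b v (THE x. (x, y) \<in> \<Gamma>)" for y
  have f: "f y = b v x" if "(x, y) \<in> \<Gamma>" for x y
  proof -
    have "(THE x. (x, y) \<in> \<Gamma>) = x" using that isometry_graph_eq_iff[OF \<Gamma>] by blast
    then show ?thesis by (simp add: f_def)
  qed
  have "\<exists>w\<in>W'. \<forall>y\<in>?Q. f y = b w y"
  proof (rule functional_representation[OF W(4,2) Q radW'])
    fix y y' assume "y \<in> ?Q" "y' \<in> ?Q"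
    then obtain x x' where *: "(x, y) \<in> \<Gamma>" "(x', y') \<in> \<Gamma>" by blast
    show "f (y + y') = f y + f y'"
      using f[OF *(1)] f[OF *(2)] f[OF isometry_graph_add[OF \<Gamma> *]] by (simp add: b_add_right)
  next
    fix c y assume "y \<in> ?Q"
    then obtain x where *: "(x, y) \<in> \<Gamma>" by blast
    show "f (c *s y) = c * f y"
      using f[OF *] f[OF isometry_graph_scale[OF \<Gamma> *]] by (simp add: b_scale_right)
  next
    \<comment> \<open>The functional vanishes on \<open>rad W'\<close> because these vectors come
      from \<open>rad W\<close>, which is orthogonal to \<open>v\<close>. A nonzero value there
      could not be represented by a vector of \<open>W'\<close>.\<close>
    fix y assume "y \<in> rad W'"
    then obtain x where *: "(x, y) \<in> \<Gamma>" "x \<in> rad W" using radW by blast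
    have "b x v = 0" using *(2) v by (simp add: perp_def)
    then show "f y = 0" using f[OF *(1)] b_orthogonal_sym by simp
  qed
  then obtain w where "w \<in> W'" and fw: "\<And>y. y \<in> ?Q \<Longrightarrow> f y = b w y" by blast
  moreover have "b v x = b w y" if "(x, y) \<in> \<Gamma>" for x y
    using f[OF that] fw[OF RangeI[OF that]] by simp
  ultimately have w: "w \<in> W'" "\<And>x y. (x, y) \<in> \<Gamma> \<Longrightarrow> b v x = b w y" by blast+
  show ?thesis
  proof (cases "w \<in> ?Q")
    case False
    then show ?thesis using w by blast
  next
    case True
    then obtain p where p: "(p, w) \<in> \<Gamma>" by blast
    have "b (v - p) x = 0" if x: "x \<in> ?P" for x
    proof -
      obtain y where y: "(x, y) \<in> \<Gamma>" using x by blast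
      show ?thesis using w(2)[OF y] isometry_graph_form[OF \<Gamma> p y] by (simp add: b_diff_left)
    qed
    moreover have "v - p \<in> W" using v p P subspace_diff[OF W(1)] by blast
    ultimately have vp: "v - p \<in> perp W ?P" by (simp add: perp_def)
    have "v - p \<notin> ?P"
    proof
      assume "v - p \<in> ?P"
      then have "(v - p) + p \<in> ?P" using p subspace_add[OF P(1)] by blast
      then show False using v by simp
    qed
    moreover have "rad ?P \<subseteq> perp W ?P" "rad ?P \<subseteq> ?P" using P by (auto simp: perp_def)
    ultimately have "rad ?P \<subset> perp W ?P" using vp by blast
    then have less: "card (rad ?P) < card (perp W ?P)"
      using finite_subset[OF perp_subset W(3)] by (intro psubset_card_mono)
    have "\<Gamma> `` rad ?P = rad ?Q"
    proof (intro equalityI subsetI)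
      fix y assume "y \<in> \<Gamma> `` rad ?P"
      then obtain x where x: "(x, y) \<in> \<Gamma>" "x \<in> rad ?P" by blast
      have "b y y' = 0" if "(x', y') \<in> \<Gamma>" for x' y'
        using isometry_graph_form[OF \<Gamma> x(1) that] x(2) DomainI[OF that] by (simp add: perp_def)
      then show "y \<in> rad ?Q" using x by (auto simp: perp_def)
    next
      fix y assume y: "y \<in> rad ?Q"
      then obtain x where x: "(x, y) \<in> \<Gamma>" using perp_subset by blast
      have "b x x' = 0" if "(x', y') \<in> \<Gamma>" for x' y'
        using isometry_graph_form[OF \<Gamma> x(1) that] y RangeI[OF that] by (simp add: perp_def)
      then have "x \<in> rad ?P" using x by (auto simp: perp_def)
      then show "y \<in> \<Gamma> `` rad ?P" using x by blast
    qed
    then have rad_eq: "card (rad ?Q) = card (rad ?P)"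
      using card_isometry_graph_Image[OF \<Gamma> perp_subset] by metis
    have "card (rad W) = card (rad W')"
      using card_isometry_graph_Image[OF \<Gamma> radW(1)] radW(2) by simp
    \<comment> \<open>Both complements have the same cardinality by \<open>card_perp\<close>, so the
      strict inequality found for \<open>?P\<close> also holds for \<open>?Q\<close>.\<close>
    then have "card ?Q * card (perp W' ?Q) = card ?P * card (perp W ?P)"
      using card_perp[OF W(3,1) P radW(1)] card_perp[OF W(4,2) Q radW'] W(5) by simp
    moreover have "card ?Q = card ?P"
      by (rule card_Range_isometry_graph[OF \<Gamma>])
    moreover have "card ?P > 0"
      using card_subspace_pos[OF P(1) finite_subset[OF P(2) W(3)]] .
    ultimately have "card (rad ?Q) < card (perp W' ?Q)" using less rad_eq by simp
    moreover have "finite (rad ?Q)" using finite_subset[OF subset_trans[OF perp_subset Q(2)] W(4)] .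
    ultimately have "\<not> perp W' ?Q \<subseteq> rad ?Q" using card_mono by (metis not_le)
    \<comment> \<open>The complement of \<open>?Q\<close> meets \<open>?Q\<close> exactly in
      \<open>rad ?Q\<close>, so a vector of it outside the radical is outside \<open>?Q\<close>.
      Adding it to \<open>w\<close> leaves all products with \<open>?Q\<close> unchanged.\<close>
    then obtain u where u: "u \<in> perp W' ?Q" "u \<notin> ?Q" by (auto simp: perp_def)
    have "w + u \<notin> ?Q"
    proof
      assume "w + u \<in> ?Q"
      then have "(w + u) - w \<in> ?Q" using True subspace_diff[OF Q(1)] by blast
      then show False using u by simp
    qed
    moreover have "w + u \<in> W'" using w u perp_subset subspace_add[OF W(2)] by blast
    moreover have "b v x = b (w + u) y" if "(x, y) \<in> \<Gamma>" for x y
      using w(2)[OF that] u that by (auto simp: perp_def b_add_left)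
    ultimately show ?thesis by blast
  qed
qed

text \<open>Witt extension for possibly degenerate spaces. That \<open>rad W\<close> goes to
  \<open>rad W'\<close> is forced, since an isometry of \<open>W\<close> onto \<open>W'\<close>
  carries radical onto radical; once this holds, a maximal graph is total by the one-vector
  step.\<close>

lemma isometry_graph_extension:
  assumes W: "subspace W" "subspace W'" "finite W" "finite W'" "card W = card W'"
    and \<Gamma>: "isometry_graph W W' \<Gamma>"
    and radW: "rad W \<subseteq> Domain \<Gamma>" "\<Gamma> `` rad W = rad W'"
  obtains \<Delta> where "isometry_graph W W' \<Delta>" "\<Gamma> \<subseteq> \<Delta>" "Domain \<Delta> = W" "Range \<Delta> = W'"
proof -
  obtain \<Delta> where \<Delta>: "isometry_graph W W' \<Delta>" "\<Gamma> \<subseteq> \<Delta>" "\<And>\<Theta>. isometry_graph W W' \<Theta> \<Longrightarrow> \<not> \<Delta> \<subset> \<Theta>"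
    using maximal_isometry_graph[OF \<Gamma>] W by blast
  have rad: "rad W \<subseteq> Domain \<Delta>" using radW \<Delta>(2) by blast
  \<comment> \<open>The radical is already in the domain of \<Gamma>, so the extension adds no new
    images for it.\<close>
  have "\<Delta> `` rad W = \<Gamma> `` rad W"
    using \<Delta>(2) radW(1) isometry_graph_eq_iff[OF \<Delta>(1)] by blast
  then have rad': "\<Delta> `` rad W = rad W'" using radW by simp
  have "Domain \<Delta> = W"
  proof (rule ccontr)
    assume "Domain \<Delta> \<noteq> W"
    then obtain v where v: "v \<in> W" "v \<notin> Domain \<Delta>" using isometry_graph_subset[OF \<Delta>(1)] by blast
    obtain w where "w \<in> W'" "w \<notin> Range \<Delta>" "\<And>x y. (x, y) \<in> \<Delta> \<Longrightarrow> b v x = b w y"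
      using isometry_graph_witt_step[OF W \<Delta>(1) rad rad' v] by blast
    then show False using isometry_graph_adjoin[OF \<Delta>(1) W(1,2) v] \<Delta>(3) by blast
  qed
  then show thesis using that \<Delta> Domain_isometry_graph_iff_Range[OF \<Delta>(1)] W by blast
qed

text \<open>The decomposition \<open>x + x'\<close> is ambiguous only by elements of
  \<open>X \<inter> X'\<close>, where both isometries restrict to \<Theta>; the same holds for
  \<open>Y \<inter> Y'\<close> on the image side. Mixed products vanish by orthogonality, so the
  form is preserved.\<close>

lemma isometry_graph_sum:
  assumes \<Gamma>: "isometry_graph X Y \<Gamma>" and \<Delta>: "isometry_graph X' Y' \<Delta>" and \<Theta>: "isometry_graph D E \<Theta>"
    and V: "subspace V" "X \<subseteq> V" "X' \<subseteq> V" "Y \<subseteq> V" "Y' \<subseteq> V"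
    and sub: "\<Theta> \<subseteq> \<Gamma>" "\<Theta> \<subseteq> \<Delta>" "X \<inter> X' \<subseteq> Domain \<Theta>" "Y \<inter> Y' \<subseteq> Range \<Theta>"
    and X: "subspace X" "subspace X'" "subspace Y" "subspace Y'"
    and orth: "\<And>x x'. x \<in> X \<Longrightarrow> x' \<in> X' \<Longrightarrow> b x x' = 0" "\<And>y y'. y \<in> Y \<Longrightarrow> y' \<in> Y' \<Longrightarrow> b y y' = 0"
  shows "isometry_graph V V {(x + x', y + y') | x y x' y'. (x, y) \<in> \<Gamma> \<and> (x', y') \<in> \<Delta>}"
    (is "isometry_graph V V ?S")
proof -
  have mem: "(x + x', y + y') \<in> ?S" if "(x, y) \<in> \<Gamma>" "(x', y') \<in> \<Delta>" for x x' y y'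
    using that by blast
  have elim: "\<exists>x x' y y'. p = x + x' \<and> q = y + y' \<and> (x, y) \<in> \<Gamma> \<and> (x', y') \<in> \<Delta>" if "(p, q) \<in> ?S" for p q
    using that by blast
  have sG: "x \<in> X \<and> y \<in> Y" if "(x, y) \<in> \<Gamma>" for x y using that isometry_graph_subset[OF \<Gamma>] by blast
  have sD: "x \<in> X' \<and> y \<in> Y'" if "(x, y) \<in> \<Delta>" for x y using that isometry_graph_subset[OF \<Delta>] by blast
  show ?thesis
    unfolding isometry_graph_def
  proof (intro conjI allI impI)
    show "?S \<subseteq> V \<times> V"
    proof
      fix z assume "z \<in> ?S"
      then obtain x x' y y' where *: "(x, y) \<in> \<Gamma>" "(x', y') \<in> \<Delta>" "z = (x + x', y + y')" by blast
      then show "z \<in> V \<times> V" using V sG[OF *(1)] sD[OF *(2)] by (auto intro!: subspace_add[OF V(1)])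
    qed
    show "(0, 0) \<in> ?S" using mem[OF isometry_graph_zero[OF \<Gamma>] isometry_graph_zero[OF \<Delta>]] by simp
  next
    fix p q p' q' assume "(p, q) \<in> ?S" "(p', q') \<in> ?S"
    then obtain x x' y y' u u' w w' where *: "p = x + x'" "q = y + y'" "(x, y) \<in> \<Gamma>" "(x', y') \<in> \<Delta>"
      "p' = u + u'" "q' = w + w'" "(u, w) \<in> \<Gamma>" "(u', w') \<in> \<Delta>"
      using elim[of p q] elim[of p' q'] by blast
    show "(p + p', q + q') \<in> ?S"
      using mem[OF isometry_graph_add[OF \<Gamma> *(3,7)] isometry_graph_add[OF \<Delta> *(4,8)]] * by (simp add: algebra_simps)
    have "b x u' = 0" "b u x' = 0" "b y w' = 0" "b w y' = 0"
      using orth sG[OF *(3)] sG[OF *(7)] sD[OF *(4)] sD[OF *(8)] by auto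
    moreover from this have "b x' u = 0" "b y' w = 0" using b_orthogonal_sym by auto
    ultimately show "b p p' = b q q'"
      using * isometry_graph_form[OF \<Gamma> *(3,7)] isometry_graph_form[OF \<Delta> *(4,8)]
      by (simp add: b_add_left b_add_right)
  next
    fix c p q assume "(p, q) \<in> ?S"
    then obtain x x' y y' where *: "p = x + x'" "q = y + y'" "(x, y) \<in> \<Gamma>" "(x', y') \<in> \<Delta>"
      using elim[of p q] by blast
    show "(c *s p, c *s q) \<in> ?S"
      using mem[OF isometry_graph_scale[OF \<Gamma> *(3)] isometry_graph_scale[OF \<Delta> *(4)]] *
      by (simp add: scale_right_distrib)
  next
    fix p q assume "(p, q) \<in> ?S"
    then obtain x x' y y' where *: "p = x + x'" "q = y + y'" "(x, y) \<in> \<Gamma>" "(x', y') \<in> \<Delta>"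
      using elim[of p q] by blast
    have m: "x \<in> X" "y \<in> Y" "x' \<in> X'" "y' \<in> Y'" using sG[OF *(3)] sD[OF *(4)] by auto
    show "p = 0 \<longleftrightarrow> q = 0"
    proof
      assume "p = 0"
      then have "x = - x'" using *(1) by (simp add: eq_neg_iff_add_eq_0)
      then have "x \<in> X \<inter> X'" using m X subspace_neg by auto
      then obtain z where "(x, z) \<in> \<Theta>" using sub by blast
      then have z: "(x, z) \<in> \<Gamma>" "(x, z) \<in> \<Delta>" using sub by auto
      have "y = z" using isometry_graph_eq_iff[OF \<Gamma> *(3) z(1)] by simp
      moreover have "z + y' = 0"
        using isometry_graph_zero_iff[OF \<Delta> isometry_graph_add[OF \<Delta> z(2) *(4)]] \<open>p = 0\<close> *(1) by simp
      ultimately show "q = 0" using *(2) by simp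
    next
      assume "q = 0"
      then have "y = - y'" using *(2) by (simp add: eq_neg_iff_add_eq_0)
      then have "y \<in> Y \<inter> Y'" using m X subspace_neg by auto
      then obtain z where "(z, y) \<in> \<Theta>" using sub by blast
      then have z: "(z, y) \<in> \<Gamma>" "(z, y) \<in> \<Delta>" using sub by auto
      have "x = z" using isometry_graph_eq_iff[OF \<Gamma> *(3) z(1)] by simp
      moreover have "z + x' = 0"
        using isometry_graph_zero_iff[OF \<Delta> isometry_graph_add[OF \<Delta> z(2) *(4)]] \<open>q = 0\<close> *(2) by simp
      ultimately show "p = 0" using *(1) by simp
    qed
  qed
qed

lemma rad_rad: "rad (rad W) = rad W"
proof (rule equalityI[OF perp_subset subsetI])
  fix x assume x: "x \<in> rad W"
  then have "b x y = 0" if "y \<in> W" for y using that by (simp add: perp_def)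
  then have "b x y = 0" if "y \<in> rad W" for y using that perp_subset by blast
  then show "x \<in> rad (rad W)" unfolding perp_def[of "rad W"] using x by blast
qed

text \<open>The form vanishes on the radicals, which have equal size, so the given graph first grows
  to a bijection between them. That bijection meets the radical condition of
  \<open>isometry_graph_extension\<close>.\<close>

lemma isometry_graph_extension_from_rad:
  assumes W: "subspace W" "subspace W'" "finite W" "finite W'" "card W = card W'" "card (rad W) = card (rad W')"
    and \<Gamma>: "isometry_graph (rad W) (rad W') \<Gamma>"
  obtains \<Delta> where "isometry_graph W W' \<Delta>" "\<Gamma> \<subseteq> \<Delta>" "Domain \<Delta> = W" "Range \<Delta> = W'"
proof -
  have fin: "finite (rad W)" "finite (rad W')" using finite_subset[OF perp_subset] W by auto
  obtain \<Theta> where \<Theta>: "isometry_graph (rad W) (rad W') \<Theta>" "\<Gamma> \<subseteq> \<Theta>" "Domain \<Theta> = rad W" "Range \<Theta> = rad W'"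
    by (rule isometry_graph_extension_isotropic
      [OF subspace_perp[OF W(1)] subspace_perp[OF W(2)] fin W(6) rad_rad rad_rad \<Gamma>])
  have "\<Theta> `` rad W = rad W'" using \<Theta>(3,4) by blast
  moreover have "rad W \<subseteq> Domain \<Theta>" using \<Theta>(3) by simp
  ultimately obtain \<Delta> where "isometry_graph W W' \<Delta>" "\<Theta> \<subseteq> \<Delta>" "Domain \<Delta> = W" "Range \<Delta> = W'"
    using isometry_graph_extension[OF W(1-5) isometry_graph_mono[OF \<Theta>(1) perp_subset perp_subset]] by metis
  then show thesis using that \<Theta>(2) by blast
qed

theorem witt_orthogonal_pairs:
  assumes V: "subspace V" "finite V" "rad V = {0}"
    and sub: "subspace X" "subspace X'" "subspace Y" "subspace Y'" "X \<subseteq> V" "X' \<subseteq> V" "Y \<subseteq> V" "Y' \<subseteq> V"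
    and orth: "\<And>x x'. x \<in> X \<Longrightarrow> x' \<in> X' \<Longrightarrow> b x x' = 0" "\<And>y y'. y \<in> Y \<Longrightarrow> y' \<in> Y' \<Longrightarrow> b y y' = 0"
    and card: "card X = card Y" "card X' = card Y'" "card (rad X) = card (rad Y)" "card (rad X') = card (rad Y')"
      "card (X \<inter> X') = card (Y \<inter> Y')"
  obtains \<Delta> where "isometry_graph V V \<Delta>" "Domain \<Delta> = V" "Range \<Delta> = V" "\<Delta> `` X = Y" "\<Delta> `` X' = Y'"
proof -
  let ?D = "X \<inter> X'" and ?E = "Y \<inter> Y'"
  have fin: "finite X" "finite X'" "finite Y" "finite Y'" using sub V finite_subset by blast+
  have finD: "finite ?D" "finite ?E" using fin by auto
  have sDE: "subspace ?D" "subspace ?E" using sub subspace_inter by auto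
  have orth': "b x' x = 0" if "x \<in> X" "x' \<in> X'" for x x'
    using orth(1)[OF that] b_orthogonal_sym[of x x'] by simp
  have orth'': "b y' y = 0" if "y \<in> Y" "y' \<in> Y'" for y y'
    using orth(2)[OF that] b_orthogonal_sym[of y y'] by simp
  have DE: "rad ?D = ?D" "rad ?E = ?E" "?D \<subseteq> rad X" "?E \<subseteq> rad Y" "?D \<subseteq> rad X'" "?E \<subseteq> rad Y'"
    unfolding perp_def using orth orth' orth'' by (blast, blast, blast, blast, blast, blast)
  \<comment> \<open>The form vanishes on both intersections, so even the zero map grows to a linear
    bijection between them.\<close>
  have "isometry_graph ?D ?E {(0, 0)}"
    using subspace_0 sub by (auto simp: isometry_graph_def)
  then obtain \<Theta> where \<Theta>: "isometry_graph ?D ?E \<Theta>" "Domain \<Theta> = ?D" "Range \<Theta> = ?E"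
    by (rule isometry_graph_extension_isotropic[OF sDE finD card(5) DE(1,2)])
  obtain \<Gamma> where \<Gamma>: "isometry_graph X Y \<Gamma>" "\<Theta> \<subseteq> \<Gamma>" "Domain \<Gamma> = X" "Range \<Gamma> = Y"
    by (rule isometry_graph_extension_from_rad
      [OF sub(1,3) fin(1,3) card(1,3) isometry_graph_mono[OF \<Theta>(1) DE(3,4)]])
  obtain \<Gamma>' where \<Gamma>': "isometry_graph X' Y' \<Gamma>'" "\<Theta> \<subseteq> \<Gamma>'" "Domain \<Gamma>' = X'" "Range \<Gamma>' = Y'"
    by (rule isometry_graph_extension_from_rad
      [OF sub(2,4) fin(2,4) card(2,4) isometry_graph_mono[OF \<Theta>(1) DE(5,6)]])
  define S where "S = {(x + x', y + y') | x y x' y'. (x, y) \<in> \<Gamma> \<and> (x', y') \<in> \<Gamma>'}"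
  have S: "isometry_graph V V S"
    unfolding S_def
    by (rule isometry_graph_sum[OF \<Gamma>(1) \<Gamma>'(1) \<Theta>(1) V(1) sub(5-8) \<Gamma>(2) \<Gamma>'(2) _ _ sub(1-4) orth]) (use \<Theta> in auto)
  \<comment> \<open>Nondegeneracy of \<open>V\<close> makes the radical condition of the last
    extension trivial.\<close>
  have "rad V \<subseteq> Domain S" "S `` rad V = rad V"
    using isometry_graph_zero[OF S] isometry_graph_zero_iff[OF S] unfolding V by auto
  then obtain \<Delta> where \<Delta>: "isometry_graph V V \<Delta>" "S \<subseteq> \<Delta>" "Domain \<Delta> = V" "Range \<Delta> = V"
    by (rule isometry_graph_extension[OF V(1) V(1) V(2) V(2) refl S])
  have "\<Gamma> \<subseteq> S" "\<Gamma>' \<subseteq> S"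
    using isometry_graph_zero[OF \<Gamma>(1)] isometry_graph_zero[OF \<Gamma>'(1)] unfolding S_def by force+
  then have *: "\<Gamma> \<subseteq> \<Delta>" "\<Gamma>' \<subseteq> \<Delta>" using \<Delta> by auto
  have "\<Delta> `` X = Y" using * \<Gamma> isometry_graph_eq_iff[OF \<Delta>(1)] by blast
  moreover have "\<Delta> `` X' = Y'" using * \<Gamma>' isometry_graph_eq_iff[OF \<Delta>(1)] by blast
  ultimately show thesis using that \<Delta> by blast
qed


text \<open>The rank of an alternating form is even. Vectors \<open>x\<close>, \<open>y\<close> with
  nonzero product span a plane whose complement \<open>W1\<close> has index \<open>q^2\<close> in
  \<open>W\<close> and the same radical, and the induction continues in \<open>W1\<close>. This
  evenness is what makes a type \<open>(m, s)\<close> exist for every subspace.\<close>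

lemma card_eq_even_power_times_card_rad:
  assumes "subspace W" "finite W"
  shows "\<exists>s. card W = CARD('a) ^ (2 * s) * card (rad W)"
  using assms
proof (induction "card W" arbitrary: W rule: less_induct)
  case less
  note W = less.prems
  show ?case
  proof (cases "rad W = W")
    case True
    then have "card W = CARD('a) ^ (2 * 0) * card (rad W)" by simp
    then show ?thesis by blast
  next
    case False
    then obtain x y where x: "x \<in> W" and y: "y \<in> W" and k: "b x y \<noteq> 0"
      unfolding perp_def by blast
    define h where "h z = (b z x, b z y)" for z
    define W1 where "W1 = {z \<in> W. h z = 0}"
    \<comment> \<open>Solves for the vector in the plane of \<open>x\<close>, \<open>y\<close> whose
      product with \<open>x\<close> is \<open>a\<close> and with \<open>y\<close> is
      \<open>c\<close>; the minus sign comes from \<open>b y x = - b x y\<close>.\<close>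
    define u where "u a c = (c / b x y) *s x + (- a / b x y) *s y" for a c
    have u: "u a c \<in> W" "h (u a c) = (a, c)" for a c
    proof -
      show "u a c \<in> W" using x y W unfolding u_def by (intro subspace_add subspace_scale)
      show "h (u a c) = (a, c)"
        using k b_swap[of y x] by (simp add: h_def u_def b_add_left b_diff_left b_scale_left b_self)
    qed
    have W1: "subspace W1"
      by (rule subspaceI)
        (auto simp: W1_def h_def zero_prod_def subspace_0[OF W(1)] subspace_add[OF W(1)]
          subspace_scale[OF W(1)] b_add_left b_scale_left)
    have finW1: "finite W1" using W by (simp add: W1_def)
    have "h ` W = UNIV"
    proof (intro equalityI subsetI)
      fix p :: "'a \<times> 'a" assume "p \<in> UNIV"
      show "p \<in> h ` W" using u[of "fst p" "snd p"] by (metis image_eqI prod.collapse)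
    qed simp
    moreover have "card W = card W1 * card (h ` W)"
      unfolding W1_def
      by (rule card_eq_card_kernel_times_card_image_subspace[OF W(2,1)])
        (simp add: h_def b_add_left)
    ultimately have card: "card W = CARD('a) ^ 2 * card W1"
      by (simp add: power2_eq_square)
    have rad: "rad W1 = rad W"
    proof (intro equalityI subsetI)
      fix z assume z: "z \<in> rad W"
      have zW: "b z w = 0" if "w \<in> W" for w using z that by (simp add: perp_def)
      have "z \<in> W1" using z zW[OF x] zW[OF y] by (simp add: W1_def h_def perp_def zero_prod_def)
      then show "z \<in> rad W1" using zW by (simp add: perp_def W1_def)
    next
      fix z assume z: "z \<in> rad W1"
      then have zxy: "b z x = 0" "b z y = 0" "z \<in> W" by (auto simp: perp_def W1_def h_def zero_prod_def)
      have "b z w = 0" if w: "w \<in> W" for w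
      proof -
        \<comment> \<open>\<open>?u\<close> has the same products with \<open>x\<close> and
          \<open>y\<close> as \<open>w\<close>, so \<open>w - ?u\<close> is the component of
          \<open>w\<close> in \<open>W1\<close>.\<close>
        let ?u = "u (b w x) (b w y)"
        have "h (w - ?u) = h w - h ?u" by (simp add: h_def b_diff_left)
        then have "w - ?u \<in> W1" using w u subspace_diff[OF W(1)] by (simp add: W1_def h_def zero_prod_def)
        then have "b z (w - ?u) = 0" using z by (simp add: perp_def)
        moreover have "b z ?u = 0" using zxy unfolding u_def b_add_right b_scale_right by simp
        ultimately show ?thesis using b_add_right[of z "w - ?u" ?u] by simp
      qed
      then show "z \<in> rad W" using zxy by (simp add: perp_def)
    qed
    have "card W1 < card W"
      unfolding card using card_subspace_pos[OF W1 finW1] card_field_ge_2[where 'a='a]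
      by (simp add: power2_eq_square less_le_trans[OF _ mult_le_mono[of 2 _ 2]])
    then obtain s where "card W1 = CARD('a) ^ (2 * s) * card (rad W)"
      using less.hyps[OF _ W1 finW1] rad by auto
    then have "card W = CARD('a) ^ (2 * Suc s) * card (rad W)"
      unfolding card by (simp add: power2_eq_square)
    then show ?thesis by blast
  qed
qed

section \<open>Sizes of sums and of their radicals\<close>

lemma card_sum_times_card_inter:
  assumes A: "subspace A" "finite A" and B: "subspace B" "finite B"
  shows "card {x + y | x y. x \<in> A \<and> y \<in> B} * card (A \<inter> B) = card A * card B"
proof -
  let ?h = "\<lambda>(x, y). x + y :: 'v"
  \<comment> \<open>Addition is a homomorphism on the product group; its kernel is the antidiagonal
    copy of \<open>A \<inter> B\<close> and its image the sum.\<close>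
  have "card (A \<times> B) = card {z \<in> A \<times> B. ?h z = 0} * card (?h ` (A \<times> B))"
    by (rule card_eq_card_kernel_times_card_image)
      (use A B in \<open>auto intro: subspace_add subspace_diff\<close>)
  moreover have "?h ` (A \<times> B) = {x + y | x y. x \<in> A \<and> y \<in> B}" by auto
  moreover have "bij_betw (\<lambda>x. (x, - x)) (A \<inter> B) {z \<in> A \<times> B. ?h z = 0}"
  proof (rule bij_betwI[where g = fst])
    show "fst \<in> {z \<in> A \<times> B. ?h z = 0} \<rightarrow> A \<inter> B"
    proof
      fix z assume "z \<in> {z \<in> A \<times> B. ?h z = 0}"
      then obtain x y where z: "z = (x, y)" "x \<in> A" "y \<in> B" "x + y = 0" by auto
      then have "x = - y" by (simp add: eq_neg_iff_add_eq_0)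
      then show "fst z \<in> A \<inter> B" using z subspace_neg[OF B(1)] by simp
    qed
  qed (auto simp: subspace_neg[OF B(1)] add_eq_0_iff)
  then have "card {z \<in> A \<times> B. ?h z = 0} = card (A \<inter> B)" by (simp add: bij_betw_same_card)
  ultimately show ?thesis by (simp add: card_cartesian_product mult.commute)
qed

text \<open>Products of \<open>x + y\<close> with \<open>A\<close> see only \<open>x\<close>, and
  those with \<open>B\<close> see only \<open>y\<close>, so the vector is radical exactly when both
  parts are.\<close>

lemma rad_sum_orthogonal:
  assumes A: "subspace A" and B: "subspace B"
    and orth: "\<And>x y. x \<in> A \<Longrightarrow> y \<in> B \<Longrightarrow> b x y = 0"
  shows "rad {x + y | x y. x \<in> A \<and> y \<in> B} = {x + y | x y. x \<in> rad A \<and> y \<in> rad B}"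
    (is "rad ?S = ?T")
proof (intro equalityI subsetI)
  have orth': "b y x = 0" if "x \<in> A" "y \<in> B" for x y
    using orth[OF that] b_orthogonal_sym[of x y] by simp
  have AS: "x \<in> ?S" if "x \<in> A" for x using that subspace_0[OF B] by force
  have BS: "y \<in> ?S" if "y \<in> B" for y using that subspace_0[OF A] by force
  {
    fix z assume z: "z \<in> rad ?S"
    then obtain x y where xy: "z = x + y" "x \<in> A" "y \<in> B" unfolding perp_def by blast
    have zS: "b z s = 0" if "s \<in> ?S" for s using z that unfolding perp_def by blast
    have "b x a = 0" if "a \<in> A" for a
      using zS[OF AS[OF that]] orth'[OF that xy(3)] xy(1) by (simp add: b_add_left)
    moreover have "b y c = 0" if "c \<in> B" for c
      using zS[OF BS[OF that]] orth[OF xy(2) that] xy(1) by (simp add: b_add_left)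
    ultimately have "x \<in> rad A" "y \<in> rad B" using xy by (auto simp: perp_def)
    then show "z \<in> ?T" using xy(1) by blast
  next
    fix z assume "z \<in> ?T"
    then obtain x y where xy: "z = x + y" "x \<in> rad A" "y \<in> rad B" by blast
    have "b z (a + c) = 0" if "a \<in> A" "c \<in> B" for a c
      using xy that orth[of x c] orth'[of a y] by (simp add: perp_def b_add_left b_add_right)
    moreover have "z \<in> ?S" using xy perp_subset by blast
    ultimately show "z \<in> rad ?S" unfolding perp_def by blast
  }
qed

text \<open>Orthogonality places \<open>A \<inter> B\<close> in both radicals, so the radicals meet
  in the same subspace as \<open>A\<close> and \<open>B\<close>, and the product formula for sums
  applies to them.\<close>

lemma card_rad_sum_times_card_inter:
  assumes A: "subspace A" "finite A" and B: "subspace B" "finite B"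
    and orth: "\<And>x y. x \<in> A \<Longrightarrow> y \<in> B \<Longrightarrow> b x y = 0"
  shows "card (rad {x + y | x y. x \<in> A \<and> y \<in> B}) * card (A \<inter> B) = card (rad A) * card (rad B)"
proof -
  have orth': "b y x = 0" if "x \<in> A" "y \<in> B" for x y
    using orth[OF that] b_orthogonal_sym[of x y] by simp
  have "rad A \<inter> rad B = A \<inter> B" unfolding perp_def using orth orth' by blast
  moreover have "rad {x + y | x y. x \<in> A \<and> y \<in> B} = {x + y | x y. x \<in> rad A \<and> y \<in> rad B}"
    by (rule rad_sum_orthogonal[OF A(1) B(1) orth])
  ultimately show ?thesis
    using card_sum_times_card_inter[OF subspace_perp[OF A(1)] finite_subset[OF perp_subset A(2)]
      subspace_perp[OF B(1)] finite_subset[OF perp_subset B(2)], of A B] by simp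
qed

section \<open>Automorphisms of the orthogonality graph\<close>

definition orthogonal :: "'v set \<Rightarrow> 'v set \<Rightarrow> bool" where
  "orthogonal A B \<longleftrightarrow> (\<forall>x\<in>A. \<forall>y\<in>B. b x y = 0)"

text \<open>With \<open>V\<close> the coordinate space, these are the vertices of the graph in the
  function model.\<close>

definition proper_subspaces :: "'v set \<Rightarrow> 'v set set" where
  "proper_subspaces V = {P. subspace P \<and> P \<subseteq> V \<and> P \<noteq> {0} \<and> P \<noteq> V}"

lemma orthogonal_sym: "orthogonal A B \<Longrightarrow> orthogonal B A"
  unfolding orthogonal_def using b_orthogonal_sym by blast

lemma orthogonal_iff_subset_perp: "A \<subseteq> V \<Longrightarrow> orthogonal A B \<longleftrightarrow> A \<subseteq> perp V B"
  unfolding orthogonal_def perp_def by blast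

context
  fixes V
  assumes V: "subspace V" "finite V" "rad V = {0}"
begin

lemma card_times_card_perp:
  assumes "subspace P" "P \<subseteq> V"
  shows "card P * card (perp V P) = card V"
  using card_perp[OF V(2,1) assms] V(3) subspace_0[OF assms(1)] by simp

text \<open>\<open>P\<close> lies in its double complement, and \<open>card_times_card_perp\<close>,
  used for \<open>P\<close> and for its complement, gives both the same size.\<close>

lemma perp_perp:
  assumes P: "subspace P" "P \<subseteq> V"
  shows "perp V (perp V P) = P"
proof -
  have Q: "subspace (perp V P)" "perp V P \<subseteq> V" using subspace_perp[OF V(1)] perp_subset by auto
  have "orthogonal (perp V P) P" using orthogonal_iff_subset_perp[OF Q(2)] by simp
  then have sub: "P \<subseteq> perp V (perp V P)"
    using orthogonal_iff_subset_perp[OF P(2)] orthogonal_sym by blast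
  have "0 < card (perp V P)" using card_subspace_pos[OF Q(1) finite_subset[OF Q(2) V(2)]] .
  then have "card P = card (perp V (perp V P))"
    using card_times_card_perp[OF P] card_times_card_perp[OF Q] by (metis mult.commute mult_cancel2 nat_neq_iff)
  then show ?thesis using card_subset_eq[OF finite_subset[OF perp_subset V(2)] sub] by simp
qed

lemma perp_proper_subspaces:
  assumes "P \<in> proper_subspaces V"
  shows "perp V P \<in> proper_subspaces V"
proof -
  have P: "subspace P" "P \<subseteq> V" "P \<noteq> {0}" "P \<noteq> V" using assms by (auto simp: proper_subspaces_def)
  have "perp V {0} = V" by (auto simp: perp_def)
  then have "perp V P \<noteq> {0}" "perp V P \<noteq> V" using perp_perp[OF P(1,2)] P(3,4) V(3) by auto
  then show ?thesis using subspace_perp[OF V(1)] perp_subset by (auto simp: proper_subspaces_def)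
qed

text \<open>For the converse direction, use that \<open>B\<^sup>\<bottom>\<close> itself is a neighbour of \<open>B\<close>.\<close>

lemma subset_iff_neighbours:
  assumes A: "A \<in> proper_subspaces V" and B: "B \<in> proper_subspaces V"
  shows "A \<subseteq> B \<longleftrightarrow> (\<forall>C\<in>proper_subspaces V. orthogonal C B \<longrightarrow> orthogonal C A)"
proof
  assume "A \<subseteq> B"
  then show "\<forall>C\<in>proper_subspaces V. orthogonal C B \<longrightarrow> orthogonal C A"
    unfolding orthogonal_def by blast
next
  assume *: "\<forall>C\<in>proper_subspaces V. orthogonal C B \<longrightarrow> orthogonal C A"
  have sub: "A \<subseteq> V" "B \<subseteq> V" "subspace B" using A B by (auto simp: proper_subspaces_def)
  have "orthogonal (perp V B) B" using orthogonal_iff_subset_perp[OF perp_subset] by simp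
  then have "orthogonal A (perp V B)"
    using * perp_proper_subspaces[OF B] orthogonal_sym by blast
  then show "A \<subseteq> B" using orthogonal_iff_subset_perp[OF sub(1)] perp_perp[OF sub(3,2)] by simp
qed

definition graph_automorphism :: "('v set \<Rightarrow> 'v set) \<Rightarrow> bool" where
  "graph_automorphism \<sigma> \<longleftrightarrow> bij_betw \<sigma> (proper_subspaces V) (proper_subspaces V) \<and>
     (\<forall>A\<in>proper_subspaces V. \<forall>B\<in>proper_subspaces V. orthogonal A B \<longleftrightarrow> orthogonal (\<sigma> A) (\<sigma> B))"

lemma graph_automorphism_closed:
  "graph_automorphism \<sigma> \<Longrightarrow> A \<in> proper_subspaces V \<Longrightarrow> \<sigma> A \<in> proper_subspaces V"
  unfolding graph_automorphism_def by (meson bij_betwE)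

lemma graph_automorphism_subset_iff:
  assumes \<sigma>: "graph_automorphism \<sigma>" and A: "A \<in> proper_subspaces V" and B: "B \<in> proper_subspaces V"
  shows "A \<subseteq> B \<longleftrightarrow> \<sigma> A \<subseteq> \<sigma> B"
proof -
  have "(\<forall>C\<in>proper_subspaces V. orthogonal C (\<sigma> B) \<longrightarrow> orthogonal C (\<sigma> A)) \<longleftrightarrow>
    (\<forall>C\<in>\<sigma> ` proper_subspaces V. orthogonal C (\<sigma> B) \<longrightarrow> orthogonal C (\<sigma> A))"
    using \<sigma> unfolding graph_automorphism_def bij_betw_def by simp
  also have "\<dots> \<longleftrightarrow> (\<forall>C\<in>proper_subspaces V. orthogonal C B \<longrightarrow> orthogonal C A)"
    using \<sigma> A B unfolding graph_automorphism_def by simp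
  finally show ?thesis
    using subset_iff_neighbours[OF A B]
      subset_iff_neighbours[OF graph_automorphism_closed[OF \<sigma> A] graph_automorphism_closed[OF \<sigma> B]] by simp
qed

lemma graph_automorphism_inverse:
  assumes \<sigma>: "graph_automorphism \<sigma>"
  shows "graph_automorphism (inv_into (proper_subspaces V) \<sigma>)"
proof -
  let ?i = "inv_into (proper_subspaces V) \<sigma>"
  have bij: "bij_betw \<sigma> (proper_subspaces V) (proper_subspaces V)" using \<sigma> by (simp add: graph_automorphism_def)
  have i: "?i A \<in> proper_subspaces V" "\<sigma> (?i A) = A" if "A \<in> proper_subspaces V" for A
    using that bij bij_betw_inv_into_right[OF bij that] bij_betwE[OF bij_betw_inv_into[OF bij]] by auto
  show ?thesis
    unfolding graph_automorphism_def
  proof (intro conjI ballI)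
    show "bij_betw ?i (proper_subspaces V) (proper_subspaces V)" by (rule bij_betw_inv_into[OF bij])
    fix A B assume "A \<in> proper_subspaces V" "B \<in> proper_subspaces V"
    then have "orthogonal (?i A) (?i B) \<longleftrightarrow> orthogonal (\<sigma> (?i A)) (\<sigma> (?i B))"
      using \<sigma> i(1) unfolding graph_automorphism_def by blast
    then show "orthogonal A B \<longleftrightarrow> orthogonal (?i A) (?i B)"
      using i(2) \<open>A \<in> proper_subspaces V\<close> \<open>B \<in> proper_subspaces V\<close> by simp
  qed
qed

text \<open>Descends through hyperplanes: each step costs \<open>A\<close> exactly the factor
  \<open>q\<close>, and its image at least that factor, since proper inclusions stay proper.\<close>

lemma card_le_card_graph_automorphism:
  assumes \<sigma>: "graph_automorphism \<sigma>" and "A \<in> proper_subspaces V"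
  shows "card A \<le> card (\<sigma> A)"
  using assms(2)
proof (induction "card A" arbitrary: A rule: less_induct)
  case less
  have A: "subspace A" "A \<subseteq> V" "A \<noteq> {0}" "A \<noteq> V" "finite A"
    using less.prems V(2) finite_subset by (auto simp: proper_subspaces_def)
  have \<sigma>A: "subspace (\<sigma> A)" "\<sigma> A \<subseteq> V" "\<sigma> A \<noteq> {0}" "finite (\<sigma> A)"
    using graph_automorphism_closed[OF \<sigma> less.prems] V(2) finite_subset by (auto simp: proper_subspaces_def)
  obtain B where B: "subspace B" "B \<subset> A" "card A = CARD('a) * card B"
    using hyperplane_exists[OF A(1,5,3)] .
  show ?case
  proof (cases "B = {0}")
    \<comment> \<open>\<open>{0}\<close> is not a vertex, so the descent stops at a line, whose
      image is nonzero and therefore has at least \<open>q\<close> elements.\<close>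
    case True
    have "{0} \<subset> \<sigma> A" using \<sigma>A(3) subspace_0[OF \<sigma>A(1)] by blast
    then show ?thesis using card_mult_le_if_psubset[OF \<sigma>A(1,4), of "{0}"] B(3) True by simp
  next
    case False
    then have vB: "B \<in> proper_subspaces V" using B A by (auto simp: proper_subspaces_def)
    have "card B < card A" using B(2) A(5) by (intro psubset_card_mono)
    then have IH: "card B \<le> card (\<sigma> B)" using less.hyps vB by blast
    have "\<sigma> B \<subset> \<sigma> A"
      using graph_automorphism_subset_iff[OF \<sigma> vB less.prems] graph_automorphism_subset_iff[OF \<sigma> less.prems vB] B(2) by blast
    moreover have "subspace (\<sigma> B)" using graph_automorphism_closed[OF \<sigma> vB] by (simp add: proper_subspaces_def)
    ultimately have "CARD('a) * card (\<sigma> B) \<le> card (\<sigma> A)" using card_mult_le_if_psubset[OF \<sigma>A(1,4)] by blast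
    then show ?thesis using IH B(3) by (metis le_trans mult_le_mono2)
  qed
qed

text \<open>A nonzero intersection is a vertex, and its image lies in both images; a zero one has
  size 1, and every finite subspace has at least that size.\<close>

lemma card_inter_le_card_inter_graph_automorphism:
  assumes \<sigma>: "graph_automorphism \<sigma>" and A: "A \<in> proper_subspaces V" and B: "B \<in> proper_subspaces V"
  shows "card (A \<inter> B) \<le> card (\<sigma> A \<inter> \<sigma> B)"
proof (cases "A \<inter> B = {0}")
  case True
  have "subspace (\<sigma> A \<inter> \<sigma> B)" "\<sigma> A \<inter> \<sigma> B \<subseteq> V"
    using graph_automorphism_closed[OF \<sigma>] A B subspace_inter by (auto simp: proper_subspaces_def)
  then show ?thesis
    using card_subspace_pos finite_subset[OF _ V(2)] True by (simp add: Suc_le_eq)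
next
  case False
  have C: "A \<inter> B \<in> proper_subspaces V" using False A B subspace_inter by (auto simp: proper_subspaces_def)
  have "\<sigma> (A \<inter> B) \<subseteq> \<sigma> A \<inter> \<sigma> B"
    using graph_automorphism_subset_iff[OF \<sigma> C A] graph_automorphism_subset_iff[OF \<sigma> C B] by blast
  moreover have "finite (\<sigma> A \<inter> \<sigma> B)"
    using graph_automorphism_closed[OF \<sigma> A] V(2) by (auto simp: proper_subspaces_def intro: finite_subset)
  ultimately show ?thesis
    using card_le_card_graph_automorphism[OF \<sigma> C] card_mono le_trans by blast
qed

text \<open>The image of the vertex \<open>perp V A\<close> is orthogonal to the image of
  \<open>A\<close>, hence part of its complement, so the estimate for intersections covers
  \<open>A \<inter> perp V A\<close>.\<close>

lemma card_rad_le_card_rad_graph_automorphism: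
  assumes \<sigma>: "graph_automorphism \<sigma>" and A: "A \<in> proper_subspaces V"
  shows "card (rad A) \<le> card (rad (\<sigma> A))"
proof -
  have P: "perp V A \<in> proper_subspaces V" by (rule perp_proper_subspaces[OF A])
  have \<sigma>A: "\<sigma> A \<subseteq> V" and \<sigma>P: "\<sigma> (perp V A) \<subseteq> V"
    using graph_automorphism_closed[OF \<sigma>] A P by (auto simp: proper_subspaces_def)
  have "A \<subseteq> V" using A by (simp add: proper_subspaces_def)
  then have rad: "rad A = A \<inter> perp V A" unfolding perp_def by blast
  have rad': "rad (\<sigma> A) = \<sigma> A \<inter> perp V (\<sigma> A)" using \<sigma>A unfolding perp_def by blast
  have "orthogonal (perp V A) A" using orthogonal_iff_subset_perp[OF perp_subset] by simp
  then have "orthogonal (\<sigma> (perp V A)) (\<sigma> A)" using \<sigma> A P unfolding graph_automorphism_def by blast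
  then have "\<sigma> (perp V A) \<subseteq> perp V (\<sigma> A)" using orthogonal_iff_subset_perp[OF \<sigma>P] by simp
  then have "\<sigma> A \<inter> \<sigma> (perp V A) \<subseteq> rad (\<sigma> A)" unfolding rad' by blast
  moreover have "finite (rad (\<sigma> A))" using finite_subset[OF subset_trans[OF perp_subset \<sigma>A] V(2)] .
  ultimately show ?thesis
    using card_inter_le_card_inter_graph_automorphism[OF \<sigma> A P] card_mono le_trans unfolding rad by blast
qed

text \<open>The inverse is an automorphism too, so each of the preceding estimates also holds in
  reverse.\<close>

lemma
  assumes \<sigma>: "graph_automorphism \<sigma>" and A: "A \<in> proper_subspaces V"
  shows card_graph_automorphism: "card (\<sigma> A) = card A"
    and card_rad_graph_automorphism: "card (rad (\<sigma> A)) = card (rad A)"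
    and card_inter_graph_automorphism:
      "\<And>B. B \<in> proper_subspaces V \<Longrightarrow> card (\<sigma> A \<inter> \<sigma> B) = card (A \<inter> B)"
proof -
  note \<sigma>' = graph_automorphism_inverse[OF \<sigma>]
  have inv: "inv_into (proper_subspaces V) \<sigma> (\<sigma> B) = B" if "B \<in> proper_subspaces V" for B
    by (rule bij_betw_inv_into_left[OF conjunct1[OF \<sigma>[unfolded graph_automorphism_def]] that])
  have \<sigma>A: "\<sigma> A \<in> proper_subspaces V" by (rule graph_automorphism_closed[OF \<sigma> A])
  show "card (\<sigma> A) = card A"
    using card_le_card_graph_automorphism[OF \<sigma> A] card_le_card_graph_automorphism[OF \<sigma>' \<sigma>A] inv[OF A] by simp
  show "card (rad (\<sigma> A)) = card (rad A)"
    using card_rad_le_card_rad_graph_automorphism[OF \<sigma> A] card_rad_le_card_rad_graph_automorphism[OF \<sigma>' \<sigma>A] inv[OF A] by simp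
  show "card (\<sigma> A \<inter> \<sigma> B) = card (A \<inter> B)" if B: "B \<in> proper_subspaces V" for B
    using card_inter_le_card_inter_graph_automorphism[OF \<sigma> A B] inv[OF A] inv[OF B]
      card_inter_le_card_inter_graph_automorphism[OF \<sigma>' \<sigma>A graph_automorphism_closed[OF \<sigma> B]] by simp
qed

lemma isometry_graph_automorphism:
  assumes \<Delta>: "isometry_graph V V \<Delta>" and dom: "Domain \<Delta> = V" "Range \<Delta> = V"
  shows "graph_automorphism (\<lambda>P. \<Delta> `` P)"
proof -
  note \<Delta>' = isometry_graph_converse[OF \<Delta>]
  have closed: "\<Theta> `` P \<in> proper_subspaces V"
    if \<Theta>: "isometry_graph V V \<Theta>" "Domain \<Theta> = V" and P: "P \<in> proper_subspaces V" for \<Theta> P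
  proof -
    have P': "subspace P" "P \<subseteq> V" "P \<noteq> {0}" "P \<noteq> V" using P by (auto simp: proper_subspaces_def)
    \<comment> \<open>Size alone tells that the image is neither zero nor everything.\<close>
    have card: "card (\<Theta> `` P) = card P" using card_isometry_graph_Image[OF \<Theta>(1)] \<Theta>(2) P'(2) by simp
    have "card P \<noteq> 1"
      using P'(3) subspace_0[OF P'(1)] by (auto simp: card_1_singleton_iff)
    moreover have "card P \<noteq> card V" using P'(2,4) V(2) card_subset_eq by blast
    ultimately have "\<Theta> `` P \<noteq> {0}" "\<Theta> `` P \<noteq> V" using card by auto
    moreover have "\<Theta> `` P \<subseteq> V" using isometry_graph_subset[OF \<Theta>(1)] by blast
    ultimately show ?thesis
      using subspace_isometry_graph_Image[OF \<Theta>(1) P'(1)] by (simp add: proper_subspaces_def)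
  qed
  have inv: "\<Delta>\<inverse> `` (\<Delta> `` P) = P" "\<Delta> `` (\<Delta>\<inverse> `` P) = P" if "P \<in> proper_subspaces V" for P
    using isometry_graph_converse_Image[OF \<Delta>, of P] isometry_graph_converse_Image[OF \<Delta>', of P] dom that
    by (auto simp: proper_subspaces_def)
  have "bij_betw (\<lambda>P. \<Delta> `` P) (proper_subspaces V) (proper_subspaces V)"
  proof (rule bij_betwI[where g = "\<lambda>P. \<Delta>\<inverse> `` P"])
    show "(\<lambda>P. \<Delta> `` P) \<in> proper_subspaces V \<rightarrow> proper_subspaces V"
      using closed[OF \<Delta> dom(1)] by (rule Pi_I)
    show "(\<lambda>P. \<Delta>\<inverse> `` P) \<in> proper_subspaces V \<rightarrow> proper_subspaces V"
      using closed[OF \<Delta>'] dom(2) by (simp add: Pi_iff)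
  qed (use inv in \<open>simp_all add: Pi_iff\<close>)
  moreover have "orthogonal A B \<longleftrightarrow> orthogonal (\<Delta> `` A) (\<Delta> `` B)"
    if AB: "A \<in> proper_subspaces V" "B \<in> proper_subspaces V" for A B
  proof
    assume *: "orthogonal A B"
    have "b x' y' = 0" if "(x, x') \<in> \<Delta>" "(y, y') \<in> \<Delta>" "x \<in> A" "y \<in> B" for x x' y y'
      using * that isometry_graph_form[OF \<Delta> that(1,2)] by (simp add: orthogonal_def)
    then show "orthogonal (\<Delta> `` A) (\<Delta> `` B)" unfolding orthogonal_def by blast
  next
    assume *: "orthogonal (\<Delta> `` A) (\<Delta> `` B)"
    have "b x y = 0" if "x \<in> A" "y \<in> B" for x y
    proof -
      have "x \<in> Domain \<Delta>" "y \<in> Domain \<Delta>" using that AB dom by (auto simp: proper_subspaces_def)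
      then obtain x' y' where xy: "(x, x') \<in> \<Delta>" "(y, y') \<in> \<Delta>" by blast
      have "b x' y' = 0" using * xy \<open>x \<in> A\<close> \<open>y \<in> B\<close> unfolding orthogonal_def by blast
      then show ?thesis using isometry_graph_form[OF \<Delta> xy] by simp
    qed
    then show "orthogonal A B" by (simp add: orthogonal_def)
  qed
  ultimately show ?thesis unfolding graph_automorphism_def by blast
qed

end

end

section \<open>Row vectors\<close>

text \<open>The type of vectors of arbitrary length is not a vector space; a vector of length \<open>n\<close> is therefore
  identified with a function on the naturals that vanishes from \<open>n\<close> on.\<close>

definition fun_scale :: "'a::field \<Rightarrow> (nat \<Rightarrow> 'a) \<Rightarrow> nat \<Rightarrow> 'a" where
  "fun_scale c f = (\<lambda>i. c * f i)"

text \<open>This is \<open>f K g^T\<close> written out, with coordinates counted from 0: index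
  \<open>i\<close> is paired with \<open>\<nu> + i\<close>, and the minus sign stands where
  \<open>f\<close> contributes its second half.\<close>

definition symp_form :: "nat \<Rightarrow> (nat \<Rightarrow> 'a::field) \<Rightarrow> (nat \<Rightarrow> 'a) \<Rightarrow> 'a" where
  "symp_form \<nu> f g = (\<Sum>i<\<nu>. f i * g (\<nu> + i) - f (\<nu> + i) * g i)"

interpretation symp: alternating_form "fun_scale :: 'a::{field,finite} \<Rightarrow> _" "symp_form \<nu>" for \<nu>
  by unfold_locales
    (simp_all add: fun_scale_def symp_form_def fun_eq_iff algebra_simps sum.distrib sum_subtractf
      sum_distrib_left)

section \<open>Passage between vectors and functions\<close>

definition coords :: "nat \<Rightarrow> 'a::zero vec \<Rightarrow> nat \<Rightarrow> 'a" where
  "coords n v = (\<lambda>i. if i < n then v $ i else 0)"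

definition coord_space :: "nat \<Rightarrow> (nat \<Rightarrow> 'a::zero) set" where
  "coord_space n = {f. \<forall>i\<ge>n. f i = 0}"

lemma coords_add: "v \<in> carrier_vec n \<Longrightarrow> w \<in> carrier_vec n \<Longrightarrow> coords n (v + w) = coords n v + coords n w"
  for v :: "'a::monoid_add vec"
  by (auto simp: coords_def fun_eq_iff)

lemma coords_smult: "v \<in> carrier_vec n \<Longrightarrow> coords n (c \<cdot>\<^sub>v v) = fun_scale c (coords n v)"
  by (auto simp: coords_def fun_eq_iff fun_scale_def)

lemma coords_zero: "coords n (0\<^sub>v n) = 0"
  by (auto simp: coords_def fun_eq_iff)

lemma vec_coords: "v \<in> carrier_vec n \<Longrightarrow> vec n (coords n v) = v"
  by (auto simp: coords_def)

lemma coords_vec: "f \<in> coord_space n \<Longrightarrow> coords n (vec n f) = f"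
  by (auto simp: coords_def coord_space_def fun_eq_iff)

lemma coords_in_coord_space: "coords n v \<in> coord_space n"
  by (auto simp: coords_def coord_space_def)

lemma bij_betw_coords: "bij_betw (coords n) (carrier_vec n) (coord_space n)"
  by (rule bij_betwI[where g = "vec n"]) (auto simp: vec_coords coords_vec coords_in_coord_space)

lemma inj_on_coords: "P \<subseteq> carrier_vec n \<Longrightarrow> inj_on (coords n) P"
  using bij_betw_coords[of n] by (auto simp: bij_betw_def intro: inj_on_subset)

lemma card_coords: "P \<subseteq> carrier_vec n \<Longrightarrow> card (coords n ` P) = card P"
  by (rule card_image[OF inj_on_coords])

lemma vec_image_coords: "P \<subseteq> carrier_vec n \<Longrightarrow> vec n ` coords n ` P = P"
  by (force simp: image_image vec_coords subset_iff)

lemma coords_image_vec: "F \<subseteq> coord_space n \<Longrightarrow> coords n ` vec n ` F = F"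
  by (force simp: image_image coords_vec subset_iff)

lemma finite_carrier_vec: "finite (carrier_vec n :: 'a::finite vec set)"
  and card_carrier_vec: "card (carrier_vec n :: 'a::finite vec set) = CARD('a) ^ n"
proof -
  have bij: "bij_betw list_of_vec (carrier_vec n :: 'a vec set) {xs. set xs \<subseteq> UNIV \<and> length xs = n}"
    by (rule bij_betwI[where g = vec_of_list]) (auto simp: vec_list list_vec intro: carrier_vecI)
  show "finite (carrier_vec n :: 'a vec set)"
    using bij_betw_finite[OF bij] finite_lists_length_eq[of "UNIV :: 'a set" n] by simp
  show "card (carrier_vec n :: 'a vec set) = CARD('a) ^ n"
    using bij_betw_same_card[OF bij] card_lists_length_eq[of "UNIV :: 'a set" n] by simp
qed

lemma subspace_coord_space: "symp.subspace (coord_space n :: (nat \<Rightarrow> 'a::{field,finite}) set)"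
  by (rule symp.subspaceI) (auto simp: coord_space_def fun_scale_def)

lemma finite_coord_space: "finite (coord_space n :: (nat \<Rightarrow> 'a::{zero,finite}) set)"
  using bij_betw_finite[OF bij_betw_coords[where 'a='a]] finite_carrier_vec by blast

text \<open>Nondegeneracy: each coordinate of \<open>f\<close> is, up to sign, its product with the
  unit vector at the partner index, which is \<open>\<nu> + i\<close> or \<open>i - \<nu>\<close>;
  from \<open>2 * \<nu>\<close> on, \<open>f\<close> is zero by membership in the space.\<close>

lemma rad_coord_space: "symp.perp \<nu> (coord_space (2 * \<nu>)) (coord_space (2 * \<nu>)) = {0 :: nat \<Rightarrow> 'a::{field,finite}}"
proof (intro equalityI subsetI)
  fix f :: "nat \<Rightarrow> 'a" assume f: "f \<in> symp.perp \<nu> (coord_space (2 * \<nu>)) (coord_space (2 * \<nu>))"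
  have orth: "symp_form \<nu> f g = 0" if "g \<in> coord_space (2 * \<nu>)" for g
    using f that by (simp add: symp.perp_def)
  have "f i = 0" for i
  proof -
    consider "i < \<nu>" | "\<nu> \<le> i" "i < 2 * \<nu>" | "2 * \<nu> \<le> i" by linarith
    then show ?thesis
    proof cases
      case 1
      let ?g = "\<lambda>j. if j = \<nu> + i then 1 else 0 :: 'a"
      have "?g \<in> coord_space (2 * \<nu>)" using 1 by (auto simp: coord_space_def)
      moreover have "symp_form \<nu> f ?g = (\<Sum>j<\<nu>. if j = i then f j else 0)"
        unfolding symp_form_def using 1 by (intro sum.cong) auto
      ultimately show ?thesis using orth[of ?g] 1 by simp
    next
      case 2
      let ?g = "\<lambda>j. if j = i - \<nu> then 1 else 0 :: 'a"
      have "?g \<in> coord_space (2 * \<nu>)" using 2 by (auto simp: coord_space_def)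
      moreover have "symp_form \<nu> f ?g = (\<Sum>j<\<nu>. if j = i - \<nu> then - f (\<nu> + j) else 0)"
        unfolding symp_form_def using 2 by (intro sum.cong) auto
      moreover have "i - \<nu> < \<nu>" using 2 by linarith
      ultimately show ?thesis using orth[of ?g] 2 by simp
    next
      case 3
      then show ?thesis using f by (simp add: symp.perp_def coord_space_def)
    qed
  qed
  then show "f \<in> {0}" by (simp add: fun_eq_iff)
next
  fix f :: "nat \<Rightarrow> 'a" assume "f \<in> {0}"
  then show "f \<in> symp.perp \<nu> (coord_space (2 * \<nu>)) (coord_space (2 * \<nu>))"
    by (simp add: symp.perp_def coord_space_def)
qed

text \<open>Bridge between subspaces of the carrier-based module and those of the function model;
  \<open>coords\<close> is injective and linear, so the closure conditions match one by one.\<close>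

lemma subspace_module_vec_iff:
  "VectorSpace.subspace class_ring P (module_vec TYPE('a::{field,finite}) n) \<longleftrightarrow>
     P \<subseteq> carrier_vec n \<and> symp.subspace (coords n ` P)"
proof -
  interpret V: vec_space "TYPE('a)" n .
  have "VectorSpace.subspace class_ring P V.V \<longleftrightarrow> P \<subseteq> carrier_vec n \<and> 0\<^sub>v n \<in> P \<and>
      (\<forall>v\<in>P. \<forall>w\<in>P. v + w \<in> P) \<and> (\<forall>c. \<forall>v\<in>P. c \<cdot>\<^sub>v v \<in> P)"
    unfolding VectorSpace.subspace_def submodule_def
    using V.vectorspace_axioms V.module_axioms by (auto simp: module_vec_simps class_ring_simps)
  moreover have "symp.subspace (coords n ` P) \<longleftrightarrow> 0\<^sub>v n \<in> P \<and>
      (\<forall>v\<in>P. \<forall>w\<in>P. v + w \<in> P) \<and> (\<forall>c. \<forall>v\<in>P. c \<cdot>\<^sub>v v \<in> P)" if P: "P \<subseteq> carrier_vec n"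
  proof -
    have mem: "coords n v \<in> coords n ` P \<longleftrightarrow> v \<in> P" if "v \<in> carrier_vec n" for v
      using inj_on_image_mem_iff[OF inj_on_coords[OF order_refl] that P] .
    have [simp]: "v \<in> carrier_vec n" if "v \<in> P" for v using P that by blast
    have "0 \<in> coords n ` P \<longleftrightarrow> 0\<^sub>v n \<in> P" using mem[of "0\<^sub>v n"] by (simp add: coords_zero)
    moreover have "coords n v + coords n w \<in> coords n ` P \<longleftrightarrow> v + w \<in> P" if "v \<in> P" "w \<in> P" for v w
      using mem[of "v + w"] that by (simp add: coords_add)
    moreover have "fun_scale c (coords n v) \<in> coords n ` P \<longleftrightarrow> c \<cdot>\<^sub>v v \<in> P" if "v \<in> P" for c v
      using mem[of "c \<cdot>\<^sub>v v"] that by (simp add: coords_smult)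
    ultimately show ?thesis unfolding symp.subspace_def by auto
  qed
  ultimately show ?thesis by blast
qed

section \<open>Bases, ranks and cardinalities\<close>

lemma bij_betw_basis_matrix:
  fixes M :: "'a::field mat"
  assumes P: "VectorSpace.subspace class_ring P (module_vec TYPE('a) n)"
    and M: "M \<in> carrier_mat m n" and dist: "distinct (rows M)"
    and basis: "vectorspace.basis class_ring (module_vec TYPE('a) n\<lparr>carrier := P\<rparr>) (set (rows M))"
  shows "bij_betw (\<lambda>c. M\<^sup>T *\<^sub>v c) (carrier_vec m) P"
proof -
  interpret V: vec_space "TYPE('a)" n .
  interpret W: vectorspace class_ring "V.vs P" by (rule V.subspace_is_vs[OF P])
  have MT: "M\<^sup>T \<in> carrier_mat n m" using M by simp
  have b: "W.lin_indpt (set (rows M))" "W.span (set (rows M)) = P" "set (rows M) \<subseteq> P"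
    using basis unfolding W.basis_def by auto
  note indep = V.span_li_not_depend[OF b(3) V.is_module[OF P]]
  have "P = V.row_space M" using b(2) indep(1) unfolding V.row_space_def by simp
  then have surj: "(\<lambda>c. M\<^sup>T *\<^sub>v c) ` carrier_vec m = P"
    using V.row_space_eq[OF M] M MT by auto
  moreover have "inj_on (\<lambda>c. M\<^sup>T *\<^sub>v c) (carrier_vec m)"
  proof (rule inj_onI)
    fix c d assume c: "c \<in> carrier_vec m" and d: "d \<in> carrier_vec m" and eq: "M\<^sup>T *\<^sub>v c = M\<^sup>T *\<^sub>v d"
    have "M\<^sup>T *\<^sub>v (c - d) = 0\<^sub>v n"
      using mult_minus_distrib_mat_vec[OF MT c d] eq MT d by simp
    \<comment> \<open>\<open>basis\<close> sees only the set of rows; distinctness keeps a repeated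
      row from producing a nontrivial relation.\<close>
    moreover have "\<not> V.lin_dep (set (cols M\<^sup>T))" using b(1) indep(2) by simp
    ultimately have "c - d = 0\<^sub>v m"
      using V.lin_depI[OF MT, of "c - d"] c d dist by auto
    then show "c = d" using c d by (metis carrier_vecD eq_iff_diff_eq_0 eq_vecI index_minus_vec(1) index_zero_vec(1))
  qed
  ultimately show ?thesis by (simp add: bij_betw_def)
qed

lemma basis_matrix_exists:
  fixes P :: "'a::{field,finite} vec set"
  assumes P: "VectorSpace.subspace class_ring P (module_vec TYPE('a) n)"
  shows "\<exists>M. M \<in> carrier_mat (vectorspace.dim class_ring (module_vec TYPE('a) n\<lparr>carrier := P\<rparr>)) n \<and>
    distinct (rows M) \<and> vectorspace.basis class_ring (module_vec TYPE('a) n\<lparr>carrier := P\<rparr>) (set (rows M))"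
proof -
  interpret V: vec_space "TYPE('a)" n .
  interpret W: vectorspace class_ring "V.vs P" by (rule V.subspace_is_vs[OF P])
  have sub: "P \<subseteq> carrier_vec n" using P unfolding subspace_module_vec_iff by simp
  then have fin: "finite P" using finite_carrier_vec finite_subset by blast
  have "W.gen_set P" using W.in_own_span[of P] W.span_is_subset2[of P] by auto
  then have "W.fin_dim" unfolding W.fin_dim_def using fin by auto
  then obtain \<beta> where \<beta>: "finite \<beta>" "W.basis \<beta>" using W.finite_basis_exists by blast
  obtain vs where vs: "set vs = \<beta>" "distinct vs" using finite_distinct_list[OF \<beta>(1)] by blast
  have "set vs \<subseteq> carrier_vec n" using vs \<beta>(2) sub unfolding W.basis_def by auto
  moreover have "W.dim = length vs" using W.dim_basis[OF \<beta>] vs distinct_card by fastforce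
  ultimately show ?thesis using vs \<beta> by (intro exI[of _ "mat_of_rows n vs"]) simp
qed

lemma card_subspace_dim:
  fixes P :: "'a::{field,finite} vec set"
  assumes P: "VectorSpace.subspace class_ring P (module_vec TYPE('a) n)"
  shows "card P = CARD('a) ^ vectorspace.dim class_ring (module_vec TYPE('a) n\<lparr>carrier := P\<rparr>)"
  using basis_matrix_exists[OF P] bij_betw_basis_matrix[OF P] bij_betw_same_card card_carrier_vec by metis

text \<open>Rank plus nullity by counting. The detour over \<open>coord_space\<close> is there
  because the counting lemma needs a type that is a group, and vectors of all lengths together do
  not form one.\<close>

lemma card_kernel_times_card_range_mat:
  fixes A :: "'a::{field,finite} mat"
  assumes A: "A \<in> carrier_mat nr nc"
  shows "card {c \<in> carrier_vec nc. A *\<^sub>v c = 0\<^sub>v nr} * card ((\<lambda>c. A *\<^sub>v c) ` carrier_vec nc) = CARD('a) ^ nc"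
proof -
  define h where "h f = coords nr (A *\<^sub>v vec nc f)" for f
  have Av: "A *\<^sub>v v \<in> carrier_vec nr" if "v \<in> carrier_vec nc" for v using A that by simp
  have vec_add: "vec nc (f + g) = vec nc f + vec nc g" for f g :: "nat \<Rightarrow> 'a" by auto
  have "card (coord_space nc :: (nat \<Rightarrow> 'a) set) = card {f \<in> coord_space nc. h f = 0} * card (h ` coord_space nc)"
    by (rule symp.card_eq_card_kernel_times_card_image_subspace[OF finite_coord_space subspace_coord_space])
      (simp add: h_def vec_add mult_add_distrib_mat_vec[OF A] coords_add[OF Av Av])
  moreover have "card (coord_space nc :: (nat \<Rightarrow> 'a) set) = CARD('a) ^ nc"
    using bij_betw_same_card[OF bij_betw_coords[of nc, where 'a='a]] card_carrier_vec by metis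
  moreover have cs: "coord_space nc = coords nc ` carrier_vec nc"
    using bij_betw_coords by (metis bij_betw_imp_surj_on)
  have "h ` coord_space nc = coords nr ` (\<lambda>c. A *\<^sub>v c) ` carrier_vec nc"
    unfolding cs h_def image_image by (intro image_cong) (auto simp: vec_coords)
  then have "card (h ` coord_space nc) = card ((\<lambda>c. A *\<^sub>v c) ` carrier_vec nc)"
    using card_coords[of "(\<lambda>c. A *\<^sub>v c) ` carrier_vec nc" nr] Av by auto
  moreover have "{f \<in> coord_space nc. h f = 0} = coords nc ` {c \<in> carrier_vec nc. A *\<^sub>v c = 0\<^sub>v nr}"
  proof -
    have "h (coords nc c) = 0 \<longleftrightarrow> A *\<^sub>v c = 0\<^sub>v nr" if "c \<in> carrier_vec nc" for c
      using inj_on_eq_iff[OF inj_on_coords[OF order_refl] Av[OF that] zero_carrier_vec[of nr]]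
      by (simp add: h_def vec_coords[OF that] coords_zero)
    then show ?thesis unfolding cs by auto
  qed
  then have "card {f \<in> coord_space nc. h f = 0} = card {c \<in> carrier_vec nc. A *\<^sub>v c = 0\<^sub>v nr}"
    using card_coords[of "{c \<in> carrier_vec nc. A *\<^sub>v c = 0\<^sub>v nr}" nc] by auto
  ultimately show ?thesis by simp
qed

text \<open>The range of \<open>A\<close> is its column space, whose dimension is the rank.\<close>

lemma card_kernel_times_power_rank:
  fixes A :: "'a::{field,finite} mat"
  assumes A: "A \<in> carrier_mat nr nc"
  shows "card {c \<in> carrier_vec nc. A *\<^sub>v c = 0\<^sub>v nr} * CARD('a) ^ vec_space.rank nr A = CARD('a) ^ nc"
proof -
  interpret V: vec_space "TYPE('a)" nr .
  have sub: "set (cols A) \<subseteq> carrier_vec nr" using A cols_dim by blast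
  have "V.span (set (cols A)) = (\<lambda>c. A *\<^sub>v c) ` carrier_vec nc"
    using V.col_space_eq[OF A] A unfolding V.col_space_def by auto
  then have "card ((\<lambda>c. A *\<^sub>v c) ` carrier_vec nc) = CARD('a) ^ V.rank A"
    using card_subspace_dim[OF V.span_is_subspace[of "set (cols A)"]] sub unfolding V.rank_def by simp
  then show ?thesis using card_kernel_times_card_range_mat[OF A] by simp
qed

section \<open>Types of subspaces\<close>

lemma symp_K_carrier: "symp_K \<nu> \<in> carrier_mat (2 * \<nu>) (2 * \<nu>)"
  unfolding symp_K_def using four_block_carrier_mat[of "0\<^sub>m \<nu> \<nu>" \<nu> \<nu> "0\<^sub>m \<nu> \<nu>" \<nu> \<nu>] by (simp add: mult_2)

lemma symp_K_index:
  "i < 2 * \<nu> \<Longrightarrow> j < 2 * \<nu> \<Longrightarrow>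
    symp_K \<nu> $$ (i, j) = (if j = \<nu> + i then 1 else if i = \<nu> + j then - 1 else 0)"
  by (auto simp: symp_K_def)

text \<open>\<open>K\<close> swaps the two halves of \<open>w\<close> and negates the half that
  moves to the end; this produces the two kinds of terms in \<open>symp_form\<close>.\<close>

lemma scalar_prod_symp_K:
  fixes v w :: "'a::field vec"
  assumes v: "v \<in> carrier_vec (2 * \<nu>)" and w: "w \<in> carrier_vec (2 * \<nu>)"
  shows "v \<bullet> (symp_K \<nu> *\<^sub>v w) = symp_form \<nu> (coords (2 * \<nu>) v) (coords (2 * \<nu>) w)"
proof -
  have split: "(\<Sum>i<\<nu> + k. f i) = (\<Sum>i<\<nu>. f i) + (\<Sum>i<k. f (\<nu> + i))" for f :: "nat \<Rightarrow> 'a" and k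
    by (induction k) (simp_all add: add.assoc)
  have Kw: "(symp_K \<nu> *\<^sub>v w) $ i = (\<Sum>j\<in>{0..<2 * \<nu>}. symp_K \<nu> $$ (i, j) * w $ j)" if "i < 2 * \<nu>" for i
    using that w symp_K_carrier[of \<nu>, where 'a='a] by (simp add: scalar_prod_def)
  have Kw1: "(symp_K \<nu> *\<^sub>v w) $ i = w $ (\<nu> + i)" if i: "i < \<nu>" for i
  proof -
    have "(symp_K \<nu> *\<^sub>v w) $ i = (\<Sum>j\<in>{0..<2 * \<nu>}. if j = \<nu> + i then w $ j else 0)"
      unfolding Kw[OF trans_less_add1[OF i, of \<nu>, folded mult_2]]
      by (rule sum.cong) (use i in \<open>auto simp: symp_K_index\<close>)
    then show ?thesis using i by simp
  qed
  have Kw2: "(symp_K \<nu> *\<^sub>v w) $ (\<nu> + i) = - w $ i" if i: "i < \<nu>" for i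
  proof -
    have "(symp_K \<nu> *\<^sub>v w) $ (\<nu> + i) = (\<Sum>j\<in>{0..<2 * \<nu>}. if j = i then - w $ j else 0)"
      unfolding Kw[OF add_strict_left_mono[OF i, of \<nu>, folded mult_2]]
      by (rule sum.cong) (use i in \<open>auto simp: symp_K_index\<close>)
    then show ?thesis using i by simp
  qed
  have "v \<bullet> (symp_K \<nu> *\<^sub>v w) = (\<Sum>i<\<nu> + \<nu>. v $ i * (symp_K \<nu> *\<^sub>v w) $ i)"
    using symp_K_carrier[of \<nu>, where 'a='a] by (simp add: scalar_prod_def atLeast0LessThan mult_2)
  also have "\<dots> = (\<Sum>i<\<nu>. v $ i * (symp_K \<nu> *\<^sub>v w) $ i) + (\<Sum>i<\<nu>. v $ (\<nu> + i) * (symp_K \<nu> *\<^sub>v w) $ (\<nu> + i))"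
    by (rule split)
  also have "\<dots> = symp_form \<nu> (coords (2 * \<nu>) v) (coords (2 * \<nu>) w)"
    unfolding symp_form_def sum.distrib[symmetric]
    by (rule sum.cong) (auto simp: Kw1 Kw2 coords_def)
  finally show ?thesis .
qed

text \<open>\<open>M K N^T\<close> is the matrix of the form with respect to the rows of
  \<open>M\<close> and \<open>N\<close>. Conditions on it thus become conditions on the subspaces,
  where the choice of bases disappears.\<close>

lemma symp_form_mat:
  fixes M N :: "'a::field mat"
  assumes M: "M \<in> carrier_mat m (2 * \<nu>)" and N: "N \<in> carrier_mat k (2 * \<nu>)"
    and c: "c \<in> carrier_vec m" and d: "d \<in> carrier_vec k"
  shows "symp_form \<nu> (coords (2 * \<nu>) (M\<^sup>T *\<^sub>v c)) (coords (2 * \<nu>) (N\<^sup>T *\<^sub>v d)) =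
    c \<bullet> ((M * symp_K \<nu> * N\<^sup>T) *\<^sub>v d)"
proof -
  have NT: "N\<^sup>T \<in> carrier_mat (2 * \<nu>) k" and MT: "M\<^sup>T \<in> carrier_mat (2 * \<nu>) m" using M N by auto
  have Nd: "N\<^sup>T *\<^sub>v d \<in> carrier_vec (2 * \<nu>)" and Mc: "M\<^sup>T *\<^sub>v c \<in> carrier_vec (2 * \<nu>)" using NT MT c d by auto
  have "(M * symp_K \<nu> * N\<^sup>T) *\<^sub>v d = M *\<^sub>v (symp_K \<nu> *\<^sub>v (N\<^sup>T *\<^sub>v d))"
    using assoc_mult_mat_vec[OF mult_carrier_mat[OF M symp_K_carrier] NT d]
      assoc_mult_mat_vec[OF M symp_K_carrier Nd] by simp
  then have "c \<bullet> ((M * symp_K \<nu> * N\<^sup>T) *\<^sub>v d) = (M\<^sup>T *\<^sub>v c) \<bullet> (symp_K \<nu> *\<^sub>v (N\<^sup>T *\<^sub>v d))"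
    using transpose_vec_mult_scalar[OF M mult_mat_vec_carrier[OF symp_K_carrier Nd] c] by simp
  then show ?thesis using scalar_prod_symp_K[OF Mc Nd] by simp
qed

abbreviation vec_subspace :: "nat \<Rightarrow> 'a::field vec set \<Rightarrow> bool" where
  "vec_subspace \<nu> P \<equiv> VectorSpace.subspace class_ring P (row_vectors \<nu>)"

abbreviation vec_rad :: "nat \<Rightarrow> 'a::{field,finite} vec set \<Rightarrow> (nat \<Rightarrow> 'a) set" where
  "vec_rad \<nu> P \<equiv> symp.rad \<nu> (coords (2 * \<nu>) ` P)"

lemma represents_exists:
  fixes P :: "'a::{field,finite} vec set"
  assumes "vec_subspace \<nu> P"
  shows "\<exists>m M. represents \<nu> m M P"
  using basis_matrix_exists[OF assms] unfolding represents_def by blast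

lemma bij_betw_represents:
  fixes P :: "'a::field vec set"
  assumes "vec_subspace \<nu> P" "represents \<nu> m M P"
  shows "bij_betw (\<lambda>c. M\<^sup>T *\<^sub>v c) (carrier_vec m) P"
  using bij_betw_basis_matrix[OF assms(1)] assms(2) unfolding represents_def by blast

lemma scalar_prod_eq_0_iff:
  fixes x :: "'a::field vec"
  assumes x: "x \<in> carrier_vec m"
  shows "(\<forall>c\<in>carrier_vec m. c \<bullet> x = 0) \<longleftrightarrow> x = 0\<^sub>v m"
proof
  assume *: "\<forall>c\<in>carrier_vec m. c \<bullet> x = 0"
  show "x = 0\<^sub>v m"
  proof (rule eq_vecI)
    fix i assume "i < dim_vec (0\<^sub>v m :: 'a vec)"
    then have i: "i < m" by simp
    have "unit_vec m i \<bullet> x = 0" using * by simp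
    then show "x $ i = 0\<^sub>v m $ i" using scalar_prod_left_unit[OF x i] i by simp
  qed (use x in simp)
next
  assume "x = 0\<^sub>v m"
  then show "\<forall>c\<in>carrier_vec m. c \<bullet> x = 0" by simp
qed

text \<open>The equivalence with \<open>M K N^T = 0\<close> is shown for every pair of representing
  matrices, which makes the choice in the existential of \<open>Spi_adj\<close> immaterial.\<close>

lemma Spi_adj_iff:
  fixes A B :: "'a::{field,finite} vec set"
  assumes A: "vec_subspace \<nu> A" and B: "vec_subspace \<nu> B"
  shows "Spi_adj \<nu> A B \<longleftrightarrow> symp.orthogonal \<nu> (coords (2 * \<nu>) ` A) (coords (2 * \<nu>) ` B)"
proof -
  have iff: "symp.orthogonal \<nu> (coords (2 * \<nu>) ` A) (coords (2 * \<nu>) ` B) \<longleftrightarrow> M * symp_K \<nu> * N\<^sup>T = 0\<^sub>m m k"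
    if M: "represents \<nu> m M A" and N: "represents \<nu> k N B" for m k M N
  proof -
    let ?G = "M * symp_K \<nu> * N\<^sup>T"
    have cM: "M \<in> carrier_mat m (2 * \<nu>)" and cN: "N \<in> carrier_mat k (2 * \<nu>)"
      using M N unfolding represents_def by auto
    have G: "?G \<in> carrier_mat m k" using cM cN symp_K_carrier[of \<nu>] by auto
    have AB: "A = (\<lambda>c. M\<^sup>T *\<^sub>v c) ` carrier_vec m" "B = (\<lambda>c. N\<^sup>T *\<^sub>v c) ` carrier_vec k"
      using bij_betw_imp_surj_on[OF bij_betw_represents[OF A M]]
        bij_betw_imp_surj_on[OF bij_betw_represents[OF B N]] by auto
    have "symp.orthogonal \<nu> (coords (2 * \<nu>) ` A) (coords (2 * \<nu>) ` B) \<longleftrightarrow>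
        (\<forall>d\<in>carrier_vec k. \<forall>c\<in>carrier_vec m. c \<bullet> (?G *\<^sub>v d) = 0)"
      unfolding symp.orthogonal_def AB using symp_form_mat[OF cM cN] by auto
    also have "\<dots> \<longleftrightarrow> (\<forall>d\<in>carrier_vec k. ?G *\<^sub>v d = 0\<^sub>v m)"
      using scalar_prod_eq_0_iff[OF mult_mat_vec_carrier[OF G]] by simp
    also have "\<dots> \<longleftrightarrow> ?G = 0\<^sub>m m k"
    proof
      assume *: "\<forall>d\<in>carrier_vec k. ?G *\<^sub>v d = 0\<^sub>v m"
      show "?G = 0\<^sub>m m k"
      proof (rule eq_matI)
        fix i j assume "i < dim_row (0\<^sub>m m k :: 'a mat)" "j < dim_col (0\<^sub>m m k :: 'a mat)"
        then have ij: "i < m" "j < k" by auto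
        have "(?G *\<^sub>v unit_vec k j) $ i = 0" using * ij by simp
        moreover have "(?G *\<^sub>v unit_vec k j) $ i = ?G $$ (i, j)"
          using carrier_matD[OF G] ij by simp
        ultimately show "?G $$ (i, j) = 0\<^sub>m m k $$ (i, j)" using ij by simp
      qed (use G in auto)
    qed (auto intro!: eq_vecI)
    finally show ?thesis .
  qed
  obtain m M k N where "represents \<nu> m M A" "represents \<nu> k N B"
    using represents_exists A B by metis
  then show ?thesis unfolding Spi_adj_def using iff by blast
qed

text \<open>Under \<open>c \<mapsto> M^T c\<close> the kernel of \<open>M K M^T\<close> corresponds
  to the radical, so rank plus nullity becomes an identity of cardinalities that no longer mentions
  \<open>M\<close>.\<close>

lemma has_type_iff:
  fixes P :: "'a::{field,finite} vec set"
  assumes P: "vec_subspace \<nu> P"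
  shows "has_type \<nu> P (m, s) \<longleftrightarrow> card P = CARD('a) ^ m \<and> card (vec_rad \<nu> P) * CARD('a) ^ (2 * s) = CARD('a) ^ m"
proof -
  have q: "CARD('a) ^ i = CARD('a) ^ j \<longleftrightarrow> i = j" for i j
    using card_field_ge_2[where 'a='a] by (intro power_inject_exp) simp
  have rep: "card P = CARD('a) ^ k \<and>
      card (vec_rad \<nu> P) * CARD('a) ^ vec_space.rank k (M * symp_K \<nu> * M\<^sup>T) = CARD('a) ^ k"
    if M: "represents \<nu> k M P" for k M
  proof -
    let ?G = "M * symp_K \<nu> * M\<^sup>T"
    have cM: "M \<in> carrier_mat k (2 * \<nu>)" using M unfolding represents_def by simp
    have G: "?G \<in> carrier_mat k k" using cM symp_K_carrier[of \<nu>] by auto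
    note bij = bij_betw_represents[OF P M]
    have P_eq: "P = (\<lambda>c. M\<^sup>T *\<^sub>v c) ` carrier_vec k" using bij_betw_imp_surj_on[OF bij] by simp
    have sub: "P \<subseteq> carrier_vec (2 * \<nu>)" using P unfolding subspace_module_vec_iff by simp
    let ?R = "(\<lambda>c. M\<^sup>T *\<^sub>v c) ` {c \<in> carrier_vec k. ?G *\<^sub>v c = 0\<^sub>v k}"
    have "coords (2 * \<nu>) (M\<^sup>T *\<^sub>v d) \<in> vec_rad \<nu> P \<longleftrightarrow> ?G *\<^sub>v d = 0\<^sub>v k" if d: "d \<in> carrier_vec k" for d
    proof -
      have "coords (2 * \<nu>) (M\<^sup>T *\<^sub>v d) \<in> vec_rad \<nu> P \<longleftrightarrow> (\<forall>c\<in>carrier_vec k. c \<bullet> (?G *\<^sub>v d) = 0)"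
        unfolding symp.perp_def P_eq using symp_form_mat[OF cM cM _ d] d
          symp.b_orthogonal_sym[of \<nu> "coords (2 * \<nu>) (M\<^sup>T *\<^sub>v d)"] by auto
      also have "\<dots> \<longleftrightarrow> ?G *\<^sub>v d = 0\<^sub>v k" by (rule scalar_prod_eq_0_iff[OF mult_mat_vec_carrier[OF G d]])
      finally show ?thesis .
    qed
    moreover have "vec_rad \<nu> P \<subseteq> coords (2 * \<nu>) ` P" by (rule symp.perp_subset)
    ultimately have "vec_rad \<nu> P = coords (2 * \<nu>) ` ?R" unfolding P_eq by blast
    moreover have "?R \<subseteq> P" using P_eq by blast
    ultimately have "card (vec_rad \<nu> P) = card ?R" using card_coords[of ?R "2 * \<nu>"] sub by simp
    also have "\<dots> = card {c \<in> carrier_vec k. ?G *\<^sub>v c = 0\<^sub>v k}"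
      using bij_betw_imp_inj_on[OF bij] by (intro card_image) (auto intro: inj_on_subset)
    finally have "card (vec_rad \<nu> P) * CARD('a) ^ vec_space.rank k ?G = CARD('a) ^ k"
      using card_kernel_times_power_rank[OF G] by simp
    then show ?thesis using bij_betw_same_card[OF bij] card_carrier_vec by metis
  qed
  show ?thesis
  proof
    assume "has_type \<nu> P (m, s)"
    then obtain M where M: "represents \<nu> m M P" "vec_space.rank m (M * symp_K \<nu> * M\<^sup>T) = 2 * s"
      unfolding has_type_def by blast
    show "card P = CARD('a) ^ m \<and> card (vec_rad \<nu> P) * CARD('a) ^ (2 * s) = CARD('a) ^ m"
      using rep[OF M(1)] M(2) by simp
  next
    assume *: "card P = CARD('a) ^ m \<and> card (vec_rad \<nu> P) * CARD('a) ^ (2 * s) = CARD('a) ^ m"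
    obtain k M where M: "represents \<nu> k M P" using represents_exists[OF P] by blast
    have "k = m" using rep[OF M] * q by simp
    moreover have "card (vec_rad \<nu> P) \<noteq> 0" using * by (metis mult_zero_left power_not_zero zero_less_card_finite less_irrefl)
    then have "vec_space.rank k (M * symp_K \<nu> * M\<^sup>T) = 2 * s"
      using rep[OF M] * q[of "vec_space.rank k (M * symp_K \<nu> * M\<^sup>T)" "2 * s"] \<open>k = m\<close>
      by (metis mult_left_cancel)
    ultimately show "has_type \<nu> P (m, s)" unfolding has_type_def using M by auto
  qed
qed

text \<open>Equal cardinalities make the two \<open>has_type\<close> predicates coincide.
  Conversely, \<open>THE\<close> carries information only if exactly one type exists: existence
  rests on the evenness of the rank, uniqueness on the injectivity of powers of
  \<open>q\<close>.\<close>

lemma subspace_type_eq_iff: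
  fixes P Q :: "'a::{field,finite} vec set"
  assumes P: "vec_subspace \<nu> P" and Q: "vec_subspace \<nu> Q"
  shows "subspace_type \<nu> P = subspace_type \<nu> Q \<longleftrightarrow>
    card P = card Q \<and> card (vec_rad \<nu> P) = card (vec_rad \<nu> Q)"
proof
  assume "card P = card Q \<and> card (vec_rad \<nu> P) = card (vec_rad \<nu> Q)"
  then have "has_type \<nu> P = has_type \<nu> Q"
    by (simp add: fun_eq_iff has_type_iff[OF P] has_type_iff[OF Q])
  then show "subspace_type \<nu> P = subspace_type \<nu> Q" by (simp add: subspace_type_def)
next
  have q: "CARD('a) ^ i = CARD('a) ^ j \<longleftrightarrow> i = j" for i j
    using card_field_ge_2[where 'a='a] by (intro power_inject_exp) simp
  have type: "has_type \<nu> R (subspace_type \<nu> R)" if R: "vec_subspace \<nu> R" for R :: "'a vec set"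
  proof -
    have R': "R \<subseteq> carrier_vec (2 * \<nu>)" "symp.subspace (coords (2 * \<nu>) ` R)"
      using R unfolding subspace_module_vec_iff by auto
    have fin: "finite (coords (2 * \<nu>) ` R)" using R'(1) finite_carrier_vec finite_subset by blast
    obtain m where m: "card R = CARD('a) ^ m" using card_subspace_dim[OF R] by blast
    obtain s where "card (coords (2 * \<nu>) ` R) = CARD('a) ^ (2 * s) * card (vec_rad \<nu> R)"
      using symp.card_eq_even_power_times_card_rad[OF R'(2) fin] by blast
    then have s: "card (vec_rad \<nu> R) * CARD('a) ^ (2 * s) = CARD('a) ^ m"
      using card_coords[OF R'(1)] m by (simp add: mult.commute)
    have "has_type \<nu> R (m, s)" using m s by (simp add: has_type_iff[OF R])
    moreover have "t = (m, s)" if t: "has_type \<nu> R t" for t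
    proof -
      obtain m' s' where t': "t = (m', s')" by (cases t)
      have m': "CARD('a) ^ m' = CARD('a) ^ m" and
        s': "card (vec_rad \<nu> R) * CARD('a) ^ (2 * s') = CARD('a) ^ m'"
        using t m unfolding t' has_type_iff[OF R] by auto
      have "card (vec_rad \<nu> R) \<noteq> 0"
        using s by (metis mult_zero_left power_not_zero zero_less_card_finite less_irrefl)
      then have "CARD('a) ^ (2 * s') = CARD('a) ^ (2 * s)" using s s' m' by (metis mult_left_cancel)
      then show ?thesis using m' q t' by simp
    qed
    ultimately show ?thesis unfolding subspace_type_def by (rule theI)
  qed
  assume eq: "subspace_type \<nu> P = subspace_type \<nu> Q"
  obtain m s where ms: "subspace_type \<nu> Q = (m, s)" by fastforce
  have "has_type \<nu> P (m, s)" "has_type \<nu> Q (m, s)" using type[OF P] type[OF Q] eq ms by auto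
  then have "card P = card Q" "card (vec_rad \<nu> P) * CARD('a) ^ (2 * s) = card (vec_rad \<nu> Q) * CARD('a) ^ (2 * s)"
    unfolding has_type_iff[OF P] has_type_iff[OF Q] by auto
  then show "card P = card Q \<and> card (vec_rad \<nu> P) = card (vec_rad \<nu> Q)" by simp
qed

section \<open>Orbits of edges\<close>

lemma Spi_verts_iff:
  fixes P :: "'a::{field,finite} vec set"
  shows "P \<in> Spi_verts \<nu> \<longleftrightarrow> P \<subseteq> carrier_vec (2 * \<nu>) \<and>
    coords (2 * \<nu>) ` P \<in> symp.proper_subspaces (coord_space (2 * \<nu>))"
proof -
  let ?n = "2 * \<nu>"
  have eq: "coords ?n ` P = coords ?n ` Q \<longleftrightarrow> P = Q" if "P \<subseteq> carrier_vec ?n" "Q \<subseteq> carrier_vec ?n" for Q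
    using inj_on_image_eq_iff[OF inj_on_coords[OF order_refl] that] .
  have "coords ?n ` P = {0} \<longleftrightarrow> P = {0\<^sub>v ?n}" if "P \<subseteq> carrier_vec ?n"
    using eq[of "{0\<^sub>v ?n}"] that by (simp add: coords_zero)
  moreover have "coords ?n ` P = coord_space ?n \<longleftrightarrow> P = carrier_vec ?n" if "P \<subseteq> carrier_vec ?n"
    using eq[of "carrier_vec ?n"] that bij_betw_imp_surj_on[OF bij_betw_coords[of ?n, where 'a='a]] by simp
  moreover have "coords ?n ` P \<subseteq> coord_space ?n" using coords_in_coord_space by blast
  ultimately show ?thesis
    unfolding Spi_verts_def symp.proper_subspaces_def subspace_module_vec_iff by blast
qed

lemma Spi_verts_subspace: "P \<in> Spi_verts \<nu> \<Longrightarrow> vec_subspace \<nu> P"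
  by (simp add: Spi_verts_def)

lemma vec_image_Spi_verts:
  fixes F :: "(nat \<Rightarrow> 'a::{field,finite}) set"
  assumes "F \<in> symp.proper_subspaces (coord_space (2 * \<nu>))"
  shows "vec (2 * \<nu>) ` F \<in> Spi_verts \<nu>" "coords (2 * \<nu>) ` vec (2 * \<nu>) ` F = F"
proof -
  have "F \<subseteq> coord_space (2 * \<nu>)" using assms by (simp add: symp.proper_subspaces_def)
  then show "coords (2 * \<nu>) ` vec (2 * \<nu>) ` F = F" by (rule coords_image_vec)
  then show "vec (2 * \<nu>) ` F \<in> Spi_verts \<nu>"
    unfolding Spi_verts_iff using assms by auto
qed

lemma coords_image_inj:
  fixes A B :: "'a::{field,finite} vec set"
  assumes "A \<in> Spi_verts \<nu>" "B \<in> Spi_verts \<nu>" "coords (2 * \<nu>) ` A = coords (2 * \<nu>) ` B"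
  shows "A = B"
proof -
  have "A \<subseteq> carrier_vec (2 * \<nu>)" "B \<subseteq> carrier_vec (2 * \<nu>)"
    using assms(1,2) unfolding Spi_verts_iff by auto
  then show ?thesis using inj_on_image_eq_iff[OF inj_on_coords[OF order_refl]] assms(3) by blast
qed

text \<open>An unordered pair does not say which end plays the first role, so reading adjacency off
  it relies on the symmetry of orthogonality.\<close>

lemma Spi_edges_iff:
  fixes A B :: "'a::{field,finite} vec set"
  shows "{A, B} \<in> Spi_edges \<nu> \<longleftrightarrow> A \<in> Spi_verts \<nu> \<and> B \<in> Spi_verts \<nu> \<and>
    symp.orthogonal \<nu> (coords (2 * \<nu>) ` A) (coords (2 * \<nu>) ` B)"
proof -
  have adj: "Spi_adj \<nu> A B \<longleftrightarrow> symp.orthogonal \<nu> (coords (2 * \<nu>) ` A) (coords (2 * \<nu>) ` B)"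
    if "A \<in> Spi_verts \<nu>" "B \<in> Spi_verts \<nu>" for A B :: "'a vec set"
    using Spi_adj_iff[OF Spi_verts_subspace Spi_verts_subspace] that by blast
  have sym: "Spi_adj \<nu> B A" if "Spi_adj \<nu> A B" "A \<in> Spi_verts \<nu>" "B \<in> Spi_verts \<nu>" for A B :: "'a vec set"
    using that adj symp.orthogonal_sym by blast
  have "{A, B} \<in> Spi_edges \<nu> \<longleftrightarrow> A \<in> Spi_verts \<nu> \<and> B \<in> Spi_verts \<nu> \<and> Spi_adj \<nu> A B"
    unfolding Spi_edges_def using sym by (auto simp: doubleton_eq_iff)
  then show ?thesis using adj by blast
qed

lemma carrier_graph_Aut:
  "carrier (graph_Aut V E) = {\<sigma> \<in> Bij V. \<forall>A\<in>V. \<forall>B\<in>V. {A, B} \<in> E \<longleftrightarrow> {\<sigma> A, \<sigma> B} \<in> E}"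
  by (simp add: graph_Aut_def)

lemma mem_Spi_Aut_iff:
  "\<sigma> \<in> carrier (Spi_Aut \<nu>) \<longleftrightarrow> \<sigma> \<in> extensional (Spi_verts \<nu>) \<and> bij_betw \<sigma> (Spi_verts \<nu>) (Spi_verts \<nu>) \<and>
     (\<forall>A\<in>Spi_verts \<nu>. \<forall>B\<in>Spi_verts \<nu>. {A, B} \<in> Spi_edges \<nu> \<longleftrightarrow> {\<sigma> A, \<sigma> B} \<in> Spi_edges \<nu>)"
  unfolding carrier_graph_Aut Bij_def by (simp only: mem_Collect_eq Int_iff conj_assoc)

lemma Spi_Aut_imp_graph_automorphism:
  fixes \<sigma> :: "'a::{field,finite} vec set \<Rightarrow> 'a vec set"
  assumes \<sigma>: "\<sigma> \<in> carrier (Spi_Aut \<nu>)"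
  obtains \<rho> where "symp.graph_automorphism \<nu> (coord_space (2 * \<nu>)) \<rho>"
    "\<And>A. A \<in> Spi_verts \<nu> \<Longrightarrow> \<rho> (coords (2 * \<nu>) ` A) = coords (2 * \<nu>) ` \<sigma> A"
proof -
  let ?n = "2 * \<nu>"
  let ?S = "symp.proper_subspaces (coord_space ?n :: (nat \<Rightarrow> 'a) set)"
  \<comment> \<open>\<open>vec\<close> inverts \<open>coords\<close> on the function model, so
    \<rho> is \<sigma> transported along that bijection.\<close>
  define \<rho> where "\<rho> F = coords ?n ` \<sigma> (vec ?n ` F)" for F
  have bij: "bij_betw \<sigma> (Spi_verts \<nu>) (Spi_verts \<nu>)" using \<sigma> unfolding mem_Spi_Aut_iff by blast
  have \<sigma>v: "\<sigma> A \<in> Spi_verts \<nu>" if "A \<in> Spi_verts \<nu>" for A using bij_betwE[OF bij] that by blast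
  have E: "coords ?n ` A \<in> ?S" if "A \<in> Spi_verts \<nu>" for A :: "'a vec set"
    using that unfolding Spi_verts_iff by blast
  have ve: "vec ?n ` coords ?n ` A = A" if "A \<in> Spi_verts \<nu>" for A :: "'a vec set"
    using that vec_image_coords unfolding Spi_verts_iff by blast
  have \<rho>: "\<rho> (coords ?n ` A) = coords ?n ` \<sigma> A" if "A \<in> Spi_verts \<nu>" for A
    unfolding \<rho>_def ve[OF that] ..
  have "bij_betw \<rho> ?S ?S"
  proof (rule bij_betw_imageI)
    show "inj_on \<rho> ?S"
    proof (rule inj_onI)
      fix F G assume F: "F \<in> ?S" and G: "G \<in> ?S" and eq: "\<rho> F = \<rho> G"
      have "\<sigma> (vec ?n ` F) = \<sigma> (vec ?n ` G)"
        using eq coords_image_inj[OF \<sigma>v \<sigma>v] vec_image_Spi_verts(1)[OF F] vec_image_Spi_verts(1)[OF G]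
        unfolding \<rho>_def by blast
      then have "vec ?n ` F = vec ?n ` G"
        using inj_onD[OF bij_betw_imp_inj_on[OF bij]] vec_image_Spi_verts(1)[OF F] vec_image_Spi_verts(1)[OF G] by blast
      then show "F = G" using vec_image_Spi_verts(2)[OF F] vec_image_Spi_verts(2)[OF G] by metis
    qed
    show "\<rho> ` ?S = ?S"
    proof (intro equalityI subsetI)
      fix F assume "F \<in> \<rho> ` ?S"
      then show "F \<in> ?S" unfolding \<rho>_def using E \<sigma>v vec_image_Spi_verts(1) by blast
    next
      fix F assume F: "F \<in> ?S"
      then obtain A where A: "A \<in> Spi_verts \<nu>" "\<sigma> A = vec ?n ` F"
        using vec_image_Spi_verts(1) bij_betw_imp_surj_on[OF bij] by (metis imageE)
      then have "F = \<rho> (coords ?n ` A)" using \<rho>[OF A(1)] vec_image_Spi_verts(2)[OF F] by simp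
      then show "F \<in> \<rho> ` ?S" using E[OF A(1)] by blast
    qed
  qed
  moreover have "symp.orthogonal \<nu> F G \<longleftrightarrow> symp.orthogonal \<nu> (\<rho> F) (\<rho> G)" if F: "F \<in> ?S" and G: "G \<in> ?S" for F G
  proof -
    let ?A = "vec ?n ` F" and ?B = "vec ?n ` G"
    have A: "?A \<in> Spi_verts \<nu>" "?B \<in> Spi_verts \<nu>"
      using vec_image_Spi_verts(1)[OF F] vec_image_Spi_verts(1)[OF G] by auto
    have "{?A, ?B} \<in> Spi_edges \<nu> \<longleftrightarrow> {\<sigma> ?A, \<sigma> ?B} \<in> Spi_edges \<nu>"
      using \<sigma> A unfolding mem_Spi_Aut_iff by blast
    then show ?thesis
      unfolding Spi_edges_iff vec_image_Spi_verts(2)[OF F] vec_image_Spi_verts(2)[OF G] \<rho>_def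
      using A \<sigma>v by blast
  qed
  ultimately have "symp.graph_automorphism \<nu> (coord_space ?n) \<rho>"
    unfolding symp.graph_automorphism_def[OF subspace_coord_space finite_coord_space rad_coord_space] by blast
  then show thesis using that \<rho> by blast
qed

text \<open>\<open>Bij\<close> contains only functions that are \<open>undefined\<close> off the
  vertex set, hence the restriction in the transported map.\<close>

lemma graph_automorphism_imp_Spi_Aut:
  fixes \<rho> :: "(nat \<Rightarrow> 'a::{field,finite}) set \<Rightarrow> (nat \<Rightarrow> 'a) set"
  assumes \<rho>: "symp.graph_automorphism \<nu> (coord_space (2 * \<nu>)) \<rho>"
  shows "(\<lambda>A\<in>Spi_verts \<nu>. vec (2 * \<nu>) ` \<rho> (coords (2 * \<nu>) ` A)) \<in> carrier (Spi_Aut \<nu>)"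
proof -
  let ?n = "2 * \<nu>"
  let ?S = "symp.proper_subspaces (coord_space ?n :: (nat \<Rightarrow> 'a) set)"
  define \<sigma> where "\<sigma> A = vec ?n ` \<rho> (coords ?n ` A)" for A
  have bij: "bij_betw \<rho> ?S ?S"
    and orth: "\<And>F G. F \<in> ?S \<Longrightarrow> G \<in> ?S \<Longrightarrow> symp.orthogonal \<nu> F G \<longleftrightarrow> symp.orthogonal \<nu> (\<rho> F) (\<rho> G)"
    using \<rho> unfolding symp.graph_automorphism_def[OF subspace_coord_space finite_coord_space rad_coord_space] by blast+
  have E: "coords ?n ` A \<in> ?S" if "A \<in> Spi_verts \<nu>" for A :: "'a vec set"
    using that unfolding Spi_verts_iff by blast
  have ve: "vec ?n ` coords ?n ` A = A" if "A \<in> Spi_verts \<nu>" for A :: "'a vec set"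
    using that vec_image_coords unfolding Spi_verts_iff by blast
  have \<rho>S: "\<rho> F \<in> ?S" if "F \<in> ?S" for F using bij_betwE[OF bij] that by blast
  have \<sigma>v: "\<sigma> A \<in> Spi_verts \<nu>" "coords ?n ` \<sigma> A = \<rho> (coords ?n ` A)" if "A \<in> Spi_verts \<nu>" for A
    using vec_image_Spi_verts[OF \<rho>S[OF E[OF that]]] unfolding \<sigma>_def by auto
  have "bij_betw \<sigma> (Spi_verts \<nu>) (Spi_verts \<nu>)"
  proof (rule bij_betw_imageI)
    show "inj_on \<sigma> (Spi_verts \<nu>)"
    proof (rule inj_onI)
      fix A B :: "'a vec set" assume A: "A \<in> Spi_verts \<nu>" and B: "B \<in> Spi_verts \<nu>" and "\<sigma> A = \<sigma> B"
      then have "\<rho> (coords ?n ` A) = \<rho> (coords ?n ` B)" using \<sigma>v(2)[OF A] \<sigma>v(2)[OF B] by simp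
      then have "coords ?n ` A = coords ?n ` B"
        using inj_onD[OF bij_betw_imp_inj_on[OF bij]] E[OF A] E[OF B] by blast
      then show "A = B" by (rule coords_image_inj[OF A B])
    qed
    show "\<sigma> ` Spi_verts \<nu> = Spi_verts \<nu>"
    proof (intro equalityI subsetI)
      fix B :: "'a vec set" assume B: "B \<in> Spi_verts \<nu>"
      obtain F where F: "F \<in> ?S" "\<rho> F = coords ?n ` B"
        using E[OF B] bij_betw_imp_surj_on[OF bij] by (metis imageE)
      have "\<sigma> (vec ?n ` F) = B"
        unfolding \<sigma>_def vec_image_Spi_verts(2)[OF F(1)] F(2) by (rule ve[OF B])
      then show "B \<in> \<sigma> ` Spi_verts \<nu>" using vec_image_Spi_verts(1)[OF F(1)] by blast
    qed (use \<sigma>v in blast)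
  qed
  then have "bij_betw (restrict \<sigma> (Spi_verts \<nu>)) (Spi_verts \<nu>) (Spi_verts \<nu>)"
    by (simp cong: bij_betw_cong)
  moreover have "{A, B} \<in> Spi_edges \<nu> \<longleftrightarrow> {\<sigma> A, \<sigma> B} \<in> Spi_edges \<nu>"
    if A: "A \<in> Spi_verts \<nu>" and B: "B \<in> Spi_verts \<nu>" for A B
    unfolding Spi_edges_iff \<sigma>v(2)[OF A] \<sigma>v(2)[OF B]
    using orth[OF E[OF A] E[OF B]] A B \<sigma>v(1) by blast
  ultimately show ?thesis unfolding mem_Spi_Aut_iff \<sigma>_def[symmetric] by simp
qed

lemma subspace_sum_coords:
  fixes A B :: "'a::{field,finite} vec set"
  assumes A: "A \<in> Spi_verts \<nu>" and B: "B \<in> Spi_verts \<nu>"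
  shows "vec_subspace \<nu> (subspace_sum \<nu> A B)"
    and "coords (2 * \<nu>) ` subspace_sum \<nu> A B =
      {x + y | x y. x \<in> coords (2 * \<nu>) ` A \<and> y \<in> coords (2 * \<nu>) ` B}"
proof -
  interpret V: vec_space "TYPE('a)" "2 * \<nu>" .
  show "vec_subspace \<nu> (subspace_sum \<nu> A B)"
    by (rule V.sum_is_subspace[OF Spi_verts_subspace[OF A] Spi_verts_subspace[OF B]])
  have sub: "A \<subseteq> carrier_vec (2 * \<nu>)" "B \<subseteq> carrier_vec (2 * \<nu>)"
    using A B unfolding Spi_verts_iff by auto
  have "subspace_sum \<nu> A B = {v + w | v w. v \<in> A \<and> w \<in> B}"
    unfolding V.submodule_sum_def by (auto simp: module_vec_simps)
  moreover have "coords (2 * \<nu>) (v + w) = coords (2 * \<nu>) v + coords (2 * \<nu>) w" if "v \<in> A" "w \<in> B" for v w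
    using coords_add[of v "2 * \<nu>" w] that sub by blast
  ultimately show "coords (2 * \<nu>) ` subspace_sum \<nu> A B =
      {x + y | x y. x \<in> coords (2 * \<nu>) ` A \<and> y \<in> coords (2 * \<nu>) ` B}"
    by (fastforce simp: image_iff)
qed

lemma subspace_sum_commute:
  fixes A B :: "'a::{field,finite} vec set"
  assumes "{A, B} \<in> Spi_edges \<nu>"
  shows "subspace_sum \<nu> A B = subspace_sum \<nu> B A"
proof -
  interpret V: vec_space "TYPE('a)" "2 * \<nu>" .
  show ?thesis using assms V.vsum_comm Spi_verts_subspace unfolding Spi_edges_iff by blast
qed

text \<open>These facts exchange the type of the sum for the size of the intersection, in either
  direction; the positivity statements allow cancelling in the products.\<close>

lemma
  fixes A B :: "'a::{field,finite} vec set"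
  assumes AB: "{A, B} \<in> Spi_edges \<nu>"
  shows card_subspace_sum: "card (subspace_sum \<nu> A B) * card (coords (2 * \<nu>) ` A \<inter> coords (2 * \<nu>) ` B) = card A * card B"
    and card_vec_rad_subspace_sum: "card (vec_rad \<nu> (subspace_sum \<nu> A B)) * card (coords (2 * \<nu>) ` A \<inter> coords (2 * \<nu>) ` B) =
      card (vec_rad \<nu> A) * card (vec_rad \<nu> B)"
    and card_inter_pos: "0 < card (coords (2 * \<nu>) ` A \<inter> coords (2 * \<nu>) ` B)"
    and card_subspace_sum_pos: "0 < card (subspace_sum \<nu> A B)"
proof -
  let ?n = "2 * \<nu>"
  have v: "A \<in> Spi_verts \<nu>" "B \<in> Spi_verts \<nu>" and orth: "symp.orthogonal \<nu> (coords ?n ` A) (coords ?n ` B)"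
    using AB unfolding Spi_edges_iff by auto
  have sub: "A \<subseteq> carrier_vec ?n" "B \<subseteq> carrier_vec ?n" "symp.subspace (coords ?n ` A)" "symp.subspace (coords ?n ` B)"
    using v unfolding Spi_verts_iff symp.proper_subspaces_def by auto
  have fin: "finite (coords ?n ` A)" "finite (coords ?n ` B)"
    using sub(1,2) finite_carrier_vec finite_subset by blast+
  note sum = subspace_sum_coords[OF v]
  have sumsub: "subspace_sum \<nu> A B \<subseteq> carrier_vec ?n" "symp.subspace (coords ?n ` subspace_sum \<nu> A B)"
    using sum(1) unfolding subspace_module_vec_iff by auto
  show eq: "card (subspace_sum \<nu> A B) * card (coords ?n ` A \<inter> coords ?n ` B) = card A * card B"
    using symp.card_sum_times_card_inter[OF sub(3) fin(1) sub(4) fin(2)]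
      card_coords[OF sumsub(1)] card_coords[OF sub(1)] card_coords[OF sub(2)] unfolding sum(2) by simp
  show "card (vec_rad \<nu> (subspace_sum \<nu> A B)) * card (coords ?n ` A \<inter> coords ?n ` B) =
      card (vec_rad \<nu> A) * card (vec_rad \<nu> B)"
    unfolding sum(2)
    by (rule symp.card_rad_sum_times_card_inter[OF sub(3) fin(1) sub(4) fin(2)])
      (use orth[unfolded symp.orthogonal_def] in blast)
  show "0 < card (coords ?n ` A \<inter> coords ?n ` B)"
    using symp.card_subspace_pos[OF symp.subspace_inter[OF sub(3,4)]] fin by blast
  have "0 < card (coords ?n ` A)" "0 < card (coords ?n ` B)"
    using symp.card_subspace_pos sub fin by blast+
  then show "0 < card (subspace_sum \<nu> A B)"
    using eq card_coords[OF sub(1)] card_coords[OF sub(2)] by (metis mult_is_0 neq0_conv)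
qed

lemma subspace_type_Spi_Aut:
  fixes \<sigma> :: "'a::{field,finite} vec set \<Rightarrow> 'a vec set"
  assumes \<sigma>: "\<sigma> \<in> carrier (Spi_Aut \<nu>)" and AB: "{A, B} \<in> Spi_edges \<nu>"
  shows "subspace_type \<nu> (\<sigma> A) = subspace_type \<nu> A"
    and "subspace_type \<nu> (subspace_sum \<nu> (\<sigma> A) (\<sigma> B)) = subspace_type \<nu> (subspace_sum \<nu> A B)"
proof -
  let ?n = "2 * \<nu>"
  note V = subspace_coord_space finite_coord_space rad_coord_space
  obtain \<rho> where \<rho>: "symp.graph_automorphism \<nu> (coord_space ?n) \<rho>"
    "\<And>A. A \<in> Spi_verts \<nu> \<Longrightarrow> \<rho> (coords ?n ` A) = coords ?n ` \<sigma> A"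
    using Spi_Aut_imp_graph_automorphism[OF \<sigma>] by blast
  have v: "A \<in> Spi_verts \<nu>" "B \<in> Spi_verts \<nu>" using AB unfolding Spi_edges_iff by auto
  have \<sigma>AB: "{\<sigma> A, \<sigma> B} \<in> Spi_edges \<nu>" using \<sigma> v AB unfolding mem_Spi_Aut_iff by blast
  then have \<sigma>v: "\<sigma> A \<in> Spi_verts \<nu>" "\<sigma> B \<in> Spi_verts \<nu>" unfolding Spi_edges_iff by auto
  have S: "coords ?n ` C \<in> symp.proper_subspaces (coord_space ?n)" if "C \<in> Spi_verts \<nu>" for C :: "'a vec set"
    using that unfolding Spi_verts_iff by blast
  have c: "card (coords ?n ` C) = card C" if "C \<in> Spi_verts \<nu>" for C :: "'a vec set"
    using that card_coords unfolding Spi_verts_iff by blast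
  have card: "card (\<sigma> C) = card C" if "C \<in> Spi_verts \<nu>" "\<sigma> C \<in> Spi_verts \<nu>" for C
    using symp.card_graph_automorphism[OF V \<rho>(1) S[OF that(1)]] \<rho>(2)[OF that(1)] c that by simp
  have rad: "card (vec_rad \<nu> (\<sigma> C)) = card (vec_rad \<nu> C)" if "C \<in> Spi_verts \<nu>" for C
    using symp.card_rad_graph_automorphism[OF V \<rho>(1) S[OF that]] \<rho>(2)[OF that] by simp
  have inter: "card (coords ?n ` \<sigma> A \<inter> coords ?n ` \<sigma> B) = card (coords ?n ` A \<inter> coords ?n ` B)"
    using symp.card_inter_graph_automorphism[OF V \<rho>(1) S[OF v(1)] S[OF v(2)]] \<rho>(2)[OF v(1)] \<rho>(2)[OF v(2)] by simp
  show "subspace_type \<nu> (\<sigma> A) = subspace_type \<nu> A"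
    using subspace_type_eq_iff[OF Spi_verts_subspace[OF \<sigma>v(1)] Spi_verts_subspace[OF v(1)]]
      card[OF v(1) \<sigma>v(1)] rad[OF v(1)] by simp
  \<comment> \<open>The sum may be the whole space, on which \<sigma> gives no information; its type
    is recovered from \<open>A\<close>, \<open>B\<close> and the size \<open>?i\<close>, a positive
    common factor.\<close>
  let ?i = "card (coords ?n ` A \<inter> coords ?n ` B)"
  have "card (subspace_sum \<nu> (\<sigma> A) (\<sigma> B)) * ?i = card (subspace_sum \<nu> A B) * ?i"
    unfolding card_subspace_sum[OF AB] card_subspace_sum[OF \<sigma>AB, unfolded inter]
      card[OF v(1) \<sigma>v(1)] card[OF v(2) \<sigma>v(2)] ..
  then have "card (subspace_sum \<nu> (\<sigma> A) (\<sigma> B)) = card (subspace_sum \<nu> A B)"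
    using card_inter_pos[OF AB] by simp
  moreover have "card (vec_rad \<nu> (subspace_sum \<nu> (\<sigma> A) (\<sigma> B))) * ?i = card (vec_rad \<nu> (subspace_sum \<nu> A B)) * ?i"
    unfolding card_vec_rad_subspace_sum[OF AB] card_vec_rad_subspace_sum[OF \<sigma>AB, unfolded inter]
      rad[OF v(1)] rad[OF v(2)] ..
  then have "card (vec_rad \<nu> (subspace_sum \<nu> (\<sigma> A) (\<sigma> B))) = card (vec_rad \<nu> (subspace_sum \<nu> A B))"
    using card_inter_pos[OF AB] by simp
  ultimately show "subspace_type \<nu> (subspace_sum \<nu> (\<sigma> A) (\<sigma> B)) = subspace_type \<nu> (subspace_sum \<nu> A B)"
    using subspace_type_eq_iff[OF subspace_sum_coords(1)[OF \<sigma>v] subspace_sum_coords(1)[OF v]] by simp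
qed

lemma Spi_Aut_exists:
  fixes X X' Y Y' :: "'a::{field,finite} vec set"
  assumes X: "{X, X'} \<in> Spi_edges \<nu>" and Y: "{Y, Y'} \<in> Spi_edges \<nu>"
    and type: "subspace_type \<nu> X = subspace_type \<nu> Y" "subspace_type \<nu> X' = subspace_type \<nu> Y'"
      "subspace_type \<nu> (subspace_sum \<nu> X X') = subspace_type \<nu> (subspace_sum \<nu> Y Y')"
  obtains \<sigma> where "\<sigma> \<in> carrier (Spi_Aut \<nu>)" "\<sigma> X = Y" "\<sigma> X' = Y'"
proof -
  let ?n = "2 * \<nu>"
  note V = subspace_coord_space finite_coord_space rad_coord_space
  have v: "X \<in> Spi_verts \<nu>" "X' \<in> Spi_verts \<nu>" "Y \<in> Spi_verts \<nu>" "Y' \<in> Spi_verts \<nu>"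
    and o: "symp.orthogonal \<nu> (coords ?n ` X) (coords ?n ` X')" "symp.orthogonal \<nu> (coords ?n ` Y) (coords ?n ` Y')"
    using X Y unfolding Spi_edges_iff by auto
  have s: "symp.subspace (coords ?n ` C)" "coords ?n ` C \<subseteq> coord_space ?n" "card (coords ?n ` C) = card C"
    "vec ?n ` coords ?n ` C = C" if "C \<in> Spi_verts \<nu>" for C :: "'a vec set"
    using that card_coords[of C ?n] vec_image_coords[of C ?n]
    unfolding Spi_verts_iff symp.proper_subspaces_def by auto
  have eq: "card X = card Y" "card X' = card Y'" "card (vec_rad \<nu> X) = card (vec_rad \<nu> Y)"
    "card (vec_rad \<nu> X') = card (vec_rad \<nu> Y')"
    using type(1,2) subspace_type_eq_iff[OF Spi_verts_subspace[OF v(1)] Spi_verts_subspace[OF v(3)]]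
      subspace_type_eq_iff[OF Spi_verts_subspace[OF v(2)] Spi_verts_subspace[OF v(4)]] by auto
  have "card (subspace_sum \<nu> X X') = card (subspace_sum \<nu> Y Y')"
    using type(3) subspace_type_eq_iff[OF subspace_sum_coords(1)[OF v(1,2)] subspace_sum_coords(1)[OF v(3,4)]] by simp
  \<comment> \<open>The sizes of the ends and of the sum fix that of the intersection, which the
    extension of isometries asks for.\<close>
  then have inter: "card (coords ?n ` X \<inter> coords ?n ` X') = card (coords ?n ` Y \<inter> coords ?n ` Y')"
    using card_subspace_sum[OF X] card_subspace_sum[OF Y] card_subspace_sum_pos[OF X] eq(1,2)
    by (metis mult_left_cancel neq0_conv)
  obtain \<Delta> where \<Delta>: "symp.isometry_graph \<nu> (coord_space ?n) (coord_space ?n) \<Delta>" "Domain \<Delta> = coord_space ?n"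
    "Range \<Delta> = coord_space ?n" "\<Delta> `` (coords ?n ` X) = coords ?n ` Y" "\<Delta> `` (coords ?n ` X') = coords ?n ` Y'"
  proof (rule symp.witt_orthogonal_pairs[OF V s(1)[OF v(1)] s(1)[OF v(2)] s(1)[OF v(3)] s(1)[OF v(4)]
        s(2)[OF v(1)] s(2)[OF v(2)] s(2)[OF v(3)] s(2)[OF v(4)]])
    show "card (coords ?n ` X) = card (coords ?n ` Y)" using s(3)[OF v(1)] s(3)[OF v(3)] eq(1) by simp
    show "card (coords ?n ` X') = card (coords ?n ` Y')" using s(3)[OF v(2)] s(3)[OF v(4)] eq(2) by simp
  qed (use o eq inter in \<open>auto simp: symp.orthogonal_def\<close>)
  let ?\<sigma> = "\<lambda>A\<in>Spi_verts \<nu>. vec ?n ` (\<Delta> `` (coords ?n ` A))"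
  have "?\<sigma> \<in> carrier (Spi_Aut \<nu>)"
    by (rule graph_automorphism_imp_Spi_Aut[OF symp.isometry_graph_automorphism[OF V \<Delta>(1-3)]])
  moreover have "?\<sigma> X = Y" "?\<sigma> X' = Y'" using v s(4)[OF v(3)] s(4)[OF v(4)] \<Delta>(4,5) by simp_all
  ultimately show thesis using that by blast
qed

theorem theorem3p7:
  fixes \<nu> :: nat and X\<^sub>1 X\<^sub>2 Y\<^sub>1 Y\<^sub>2 :: "'a::{finite, field} vec set"
  assumes "\<nu> \<ge> 1"
    and "{X\<^sub>1, X\<^sub>2} \<in> Spi_edges \<nu>"
    and "{Y\<^sub>1, Y\<^sub>2} \<in> Spi_edges \<nu>"
  shows "(\<exists>Orb \<in> Spi_edge_orbits \<nu>. {X\<^sub>1, X\<^sub>2} \<in> Orb \<and> {Y\<^sub>1, Y\<^sub>2} \<in> Orb) \<longleftrightarrow>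
    (subspace_type \<nu> X\<^sub>1 = subspace_type \<nu> Y\<^sub>1 \<and>
     subspace_type \<nu> X\<^sub>2 = subspace_type \<nu> Y\<^sub>2 \<and>
     subspace_type \<nu> (subspace_sum \<nu> X\<^sub>1 X\<^sub>2) = subspace_type \<nu> (subspace_sum \<nu> Y\<^sub>1 Y\<^sub>2)) \<or>
    (subspace_type \<nu> X\<^sub>1 = subspace_type \<nu> Y\<^sub>2 \<and>
     subspace_type \<nu> X\<^sub>2 = subspace_type \<nu> Y\<^sub>1 \<and>
     subspace_type \<nu> (subspace_sum \<nu> X\<^sub>1 X\<^sub>2) = subspace_type \<nu> (subspace_sum \<nu> Y\<^sub>1 Y\<^sub>2))"
    (is "?L \<longleftrightarrow> ?R")
proof
  \<comment> \<open>Both edges are images of the edge \<open>e\<close> that generates the orbit, so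
    each is compared with \<open>e\<close>; inverses and products of automorphisms do not
    enter.\<close>
  assume ?L
  then obtain e \<sigma> \<tau> where e: "e \<in> Spi_edges \<nu>" and \<sigma>: "\<sigma> \<in> carrier (Spi_Aut \<nu>)" "{X\<^sub>1, X\<^sub>2} = edge_action (Spi_edges \<nu>) \<sigma> e"
    and \<tau>: "\<tau> \<in> carrier (Spi_Aut \<nu>)" "{Y\<^sub>1, Y\<^sub>2} = edge_action (Spi_edges \<nu>) \<tau> e"
    unfolding orbits_def orbit_def by auto
  obtain A B where AB: "e = {A, B}" using e unfolding Spi_edges_def by blast
  have AB': "{A, B} \<in> Spi_edges \<nu>" "{B, A} \<in> Spi_edges \<nu>" using e AB by (auto simp: insert_commute)
  have eq: "{X\<^sub>1, X\<^sub>2} = {\<sigma> A, \<sigma> B}" "{Y\<^sub>1, Y\<^sub>2} = {\<tau> A, \<tau> B}"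
    using \<sigma>(2) \<tau>(2) e AB by (auto simp: edge_action_def)
  have inv: "subspace_type \<nu> (\<phi> A) = subspace_type \<nu> A" "subspace_type \<nu> (\<phi> B) = subspace_type \<nu> B"
    "subspace_type \<nu> (subspace_sum \<nu> (\<phi> A) (\<phi> B)) = subspace_type \<nu> (subspace_sum \<nu> A B)"
    if "\<phi> \<in> carrier (Spi_Aut \<nu>)" for \<phi>
    using subspace_type_Spi_Aut[OF that AB'(1)] subspace_type_Spi_Aut[OF that AB'(2)] by auto
  \<comment> \<open>An equation of doubletons allows two matchings of the ends. For the two edges
    together this leaves a parallel or a crossed matching, the two cases of the claim.\<close>
  have X: "subspace_type \<nu> (subspace_sum \<nu> X\<^sub>1 X\<^sub>2) = subspace_type \<nu> (subspace_sum \<nu> A B) \<and>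
    (subspace_type \<nu> X\<^sub>1 = subspace_type \<nu> A \<and> subspace_type \<nu> X\<^sub>2 = subspace_type \<nu> B \<or>
     subspace_type \<nu> X\<^sub>1 = subspace_type \<nu> B \<and> subspace_type \<nu> X\<^sub>2 = subspace_type \<nu> A)"
    using eq(1) inv[OF \<sigma>(1)] subspace_sum_commute[OF assms(2)] unfolding doubleton_eq_iff by auto
  have Y: "subspace_type \<nu> (subspace_sum \<nu> Y\<^sub>1 Y\<^sub>2) = subspace_type \<nu> (subspace_sum \<nu> A B) \<and>
    (subspace_type \<nu> Y\<^sub>1 = subspace_type \<nu> A \<and> subspace_type \<nu> Y\<^sub>2 = subspace_type \<nu> B \<or>
     subspace_type \<nu> Y\<^sub>1 = subspace_type \<nu> B \<and> subspace_type \<nu> Y\<^sub>2 = subspace_type \<nu> A)"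
    using eq(2) inv[OF \<tau>(1)] subspace_sum_commute[OF assms(3)] unfolding doubleton_eq_iff by auto
  show ?R using X Y by auto
next
  have Y': "{Y\<^sub>2, Y\<^sub>1} \<in> Spi_edges \<nu>" using assms(3) by (simp add: insert_commute)
  assume ?R
  then obtain \<sigma> where \<sigma>: "\<sigma> \<in> carrier (Spi_Aut \<nu>)" "{\<sigma> X\<^sub>1, \<sigma> X\<^sub>2} = {Y\<^sub>1, Y\<^sub>2}"
  proof (elim disjE conjE, goal_cases)
    case 1
    show ?case using Spi_Aut_exists[OF assms(2,3)] 1 by metis
  next
    case 2
    \<comment> \<open>Crossed types: the existence result is applied to the second edge read
      backwards.\<close>
    obtain \<sigma> where "\<sigma> \<in> carrier (Spi_Aut \<nu>)" "\<sigma> X\<^sub>1 = Y\<^sub>2" "\<sigma> X\<^sub>2 = Y\<^sub>1"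
      using Spi_Aut_exists[OF assms(2) Y' 2(2,3)] 2(4) subspace_sum_commute[OF assms(3)] by metis
    then show ?case using 2(1)[of \<sigma>] by (simp add: insert_commute)
  qed
  \<comment> \<open>An automorphism fixing both ends places the edge in its own orbit; comparing the
    edge with itself provides one, without appeal to the group structure.\<close>
  obtain \<iota> where \<iota>: "\<iota> \<in> carrier (Spi_Aut \<nu>)" "\<iota> X\<^sub>1 = X\<^sub>1" "\<iota> X\<^sub>2 = X\<^sub>2"
    using Spi_Aut_exists[OF assms(2,2)] by blast
  let ?O = "orbit (Spi_Aut \<nu>) (edge_action (Spi_edges \<nu>)) {X\<^sub>1, X\<^sub>2}"
  have "?O \<in> Spi_edge_orbits \<nu>" unfolding orbits_def using assms(2) by blast
  moreover have mem: "{\<phi> X\<^sub>1, \<phi> X\<^sub>2} \<in> ?O" if "\<phi> \<in> carrier (Spi_Aut \<nu>)" for \<phi>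
  proof -
    have "{\<phi> X\<^sub>1, \<phi> X\<^sub>2} = edge_action (Spi_edges \<nu>) \<phi> {X\<^sub>1, X\<^sub>2}"
      using assms(2) by (simp add: edge_action_def)
    then show ?thesis unfolding orbit_def using that by blast
  qed
  moreover have "{X\<^sub>1, X\<^sub>2} \<in> ?O" "{Y\<^sub>1, Y\<^sub>2} \<in> ?O"
    using mem[OF \<iota>(1)] mem[OF \<sigma>(1)] unfolding \<iota>(2,3) \<sigma>(2) by blast+
  ultimately show ?L by blast
qed

end
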